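(* Suppose that Assumption A (stated in the context) holds. Consider the linear system $$\begin{bmatrix}\mathcal{L}_{zz}(z,\lambda)+E_{11}&\nabla g_{\mathcal{B}}(z)+E_{12}&\nabla g_{\mathcal{N}}(z)+E_{13}\\ \nabla g_{\mathcal{B}}(z)^T+E_{21}&-D_{\mathcal{B}}+E_{22}&E_{23}\\ \nabla g_{\mathcal{N}}(z)^T+E_{31}&E_{32}&-D_{\mathcal{N}}+E_{33}\end{bmatrix}\begin{bmatrix}w\\ y\\ q\end{bmatrix}=\begin{bmatrix}r_5\\ \nabla g_{\mathcal{B}}(z^* )^Tr_6+r_7\\ r_8\end{bmatrix},$$ where $D_{\mathcal{B}}=\Lambda_{\mathcal{B}}^{-1}S_{\mathcal{B}}$, $D_{\mathcal{N}}=\Lambda_{\mathcal{N}}^{-1}S_{\mathcal{N}}$, $r_5,r_6\in\mathbb{R}^n$, $r_7\in\mathbb{R}^{|\mathcal{B}|}$, $r_8\in\mathbb{R}^{|\mathcal{N}|}$ are arbitrary, and $$E_{11}=\delta_{\mathbf u}/\mu,\quad E_{33}=\delta_{\mathbf u}/\mu^2,\quad E_{12},E_{21},E_{22}=\delta_{\mathbf u},\quad E_{13},E_{31},E_{23},E_{32}=\delta_{\mathbf u}/\mu.$$ Then the step $(w,y,q)$ satisfies $$(U^Ty,w)=O(\|r_5\|+\|r_6\|+\|r_7\|+\mu\|r_8\|),$$ $$V^Ty=O\big(\|r_5\|+\|r_6\|+\|r_7\|/\mu+(\delta_{\mathbf u}/\mu+O(\mu))\|r_8\|\big),$$ $$q=O(\mu)\big[\|r_5\|+\|r_6\|+\|r_8\|\big]+(\delta_{\mathbf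 u}/\mu+O(\mu))\|r_7\|.$$
   Context: (NLP) is $\min_z\phi(z)$ subject to $g(z)\le0$, where $\phi:\mathbb{R}^n\to\mathbb{R}$ and $g:\mathbb{R}^n\to\mathbb{R}^m$ are twice Lipschitz continuously differentiable. $\mathcal{L}(z,\lambda)=\phi(z)+\lambda^Tg(z)$; $\mathcal{L}_z$, $\mathcal{L}_{zz}$ are its gradient and Hessian in $z$. KKT conditions: $\mathcal{L}_z(z,\lambda)=0$, $g(z)\le0$, $\lambda\ge0$, $\lambda^Tg(z)=0$. $\mathcal{S}_\lambda$ is the set of $\lambda^*$ such that $(z^*,\lambda^* )$ satisfies the KKT conditions, $\mathcal{S}=\{z^*\}\times\mathcal{S}_\lambda$, $\delta(z,\lambda)$ is the Euclidean distance from $(z,\lambda)$ to $\mathcal{S}$. $\mathcal{B}=\{i:g_i(z^* )=0\}$, $\mathcal{N}=\{1,\dots,m\}\setminus\mathcal{B}$, $\mathcal{B}_+=\{i\in\mathcal{B}:\lambda_i^*>0\text{ for some }\lambda^*\in\mathcal{S}_\lambda\}$. $\nabla g_{\mathcal{B}}(z)$, $\nabla g_{\mathcal{N}}(z)$ have columns $\nabla g_i(z)$, $i\in\mathcal{B}$, resp. $i\in\mathcal{N}$. $S_{\mathcal{B}},\Lambda_{\mathcal{B}}$ are the diagonal matrices of $s_i,\lambda_i$, $i\in\mathcal{B}$; similarly for $\mathcal{N}$. SVD: $\nabla g_{\mathcal{B}}(z^* )=\begin{bmatrix}\hat U&\hat V\end{bmatrix}\begin{bmatrix}\Sigma&0\\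 0&0\end{bmatrix}\begin{bmatrix}U^T\\ V^T\end{bmatrix}=\hat U\Sigma U^T$ with $[\hat U\ \hat V]$, $[U\ V]$ orthogonal and $\Sigma$ diagonal with positive diagonal. $\sigma_{\min}$ denotes smallest eigenvalue. $\mathbf u\ge0$ is the unit roundoff, treated as a parameter. Assumption A. (a) $z^*$ is a solution of (NLP), so the KKT conditions hold ($\mathcal{S}_\lambda\neq\emptyset$). MFCQ: there is $\bar y$ with $\nabla g_{\mathcal{B}}(z^* )^T\bar y<0$. Second-order conditions: there is $\xi>0$ with $w^T\mathcal{L}_{zz}(z^*,\lambda^* )w\ge\xi\|w\|^2$ for all $\lambda^*\in\mathcal{S}_\lambda$ and all $w$ with $\nabla g_i(z^* )^Tw=0$ ($i\in\mathcal{B}_+$), $\nabla g_i(z^* )^Tw\le0$ ($i\in\mathcal{B}\setminus\mathcal{B}_+$). SC: some $\lambda^*\in\mathcal{S}_\lambda$ has $\lambda_i^*>0$ for all $i\in\mathcal{B}$. The current iterate $(z,\lambda,s)$ satisfies, with $\mu=\lambda^Ts/m$ and fixed constants $C>0$, $\gamma\in(0,1)$: $\|\mathcal{L}_z(z,\lambda)\|\le C\mu$, $\|g(z)+s\|\le C\mu$, $(\lambda,s)>0$, $\lambda_is_i\ge\gamma\mu$ for all $i$. (b) For a sufficiently large $\beta>0$: $\mathbf u/\mu\ll1$, $\mathbf u\ll1$, $\sigma_{\min}(\Sigma)\ge\beta\max(\mu^{1/3},\mathbf u/\mu)$, and $\sigma_{\min}(\hat V^T\mathcal{L}_{zz}(z^*,\lambda^*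 )\hat V)\ge\beta\max(\mu^{1/3},\mathbf u/\mu)$ for all $\lambda^*\in\mathcal{S}_\lambda$. Conventions: $O(\epsilon)$ means norm at most a constant times $\epsilon$; $\delta_{\mathbf u}$ denotes any quantity of norm at most a constant times $\mathbf u$. Precisely: for fixed problem, $z^*$, $C,\gamma$ and every choice of the constants implicit in the hypotheses, there exist $\epsilon,\eta,\beta_0,K'>0$ depending only on these such that, whenever the hypotheses hold with $\delta(z,\lambda)\le\epsilon$, $\mu\le\epsilon$, $\mathbf u/\mu\le\eta$, $\mathbf u\le\eta$, $\beta\ge\beta_0$, the conclusions hold with all implied constants equal to $K'$. *)

theory Defs
  imports "HOL-Analysis.Analysis" "Jordan_Normal_Form.Char_Poly"
begin

(* Jordan_Normal_Form supplies eigenvalues of matrices of arbitrary, possibly zero, size.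
   Its syntax that clashes with HOL-Analysis is switched off. *)
no_notation Matrix.vec_index (infixl "$" 100)
no_notation Matrix.scalar_prod (infix "\<bullet>" 70)
hide_const (open) Matrix.mat Matrix.vec Matrix.row Matrix.col Determinant.det

definition gradient :: "(real^'n \<Rightarrow> real) \<Rightarrow> real^'n \<Rightarrow> real^'n" where
  "gradient f z = (THE d. GDERIV f z :> d)"

definition hessian :: "(real^'n \<Rightarrow> real) \<Rightarrow> real^'n \<Rightarrow> real^'n^'n" where
  "hessian f z = jacobian (gradient f) (at z)"

(* Lipschitz continuity of the second derivative is only required locally, which is implied by
   a global Lipschitz condition. *)
definition twice_lipschitz_differentiable :: "(real^'n \<Rightarrow> real) \<Rightarrow> bool" where
  "twice_lipschitz_differentiable f \<longleftrightarrow>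
     (\<forall>z. f differentiable (at z)) \<and>
     (\<forall>z. gradient f differentiable (at z)) \<and>
     (\<forall>z. \<exists>e>0. \<exists>L. L-lipschitz_on (ball z e) (hessian f))"

definition lagrangian :: "(real^'n \<Rightarrow> real) \<Rightarrow> (real^'n \<Rightarrow> real^'m) \<Rightarrow> real^'n \<Rightarrow> real^'m \<Rightarrow> real" where
  "lagrangian \<phi> g z l = \<phi> z + l \<bullet> g z"

definition lagrangian_z ::
    "(real^'n \<Rightarrow> real) \<Rightarrow> (real^'n \<Rightarrow> real^'m) \<Rightarrow> real^'n \<Rightarrow> real^'m \<Rightarrow> real^'n" where
  "lagrangian_z \<phi> g z l = gradient (\<lambda>x. lagrangian \<phi> g x l) z"

definition lagrangian_zz ::
    "(real^'n \<Rightarrow> real) \<Rightarrow> (real^'n \<Rightarrow> real^'m) \<Rightarrow> real^'n \<Rightarrow> real^'m \<Rightarrow> real^'n^'n" where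
  "lagrangian_zz \<phi> g z l = hessian (\<lambda>x. lagrangian \<phi> g x l) z"

definition kkt :: "(real^'n \<Rightarrow> real) \<Rightarrow> (real^'n \<Rightarrow> real^'m) \<Rightarrow> real^'n \<Rightarrow> real^'m \<Rightarrow> bool" where
  "kkt \<phi> g z l \<longleftrightarrow>
     lagrangian_z \<phi> g z l = 0 \<and> (\<forall>i. g z $ i \<le> 0) \<and> (\<forall>i. 0 \<le> l $ i) \<and> l \<bullet> g z = 0"

definition nlp_local_solution :: "(real^'n \<Rightarrow> real) \<Rightarrow> (real^'n \<Rightarrow> real^'m) \<Rightarrow> real^'n \<Rightarrow> bool" where
  "nlp_local_solution \<phi> g zs \<longleftrightarrow>
     (\<forall>i. g zs $ i \<le> 0) \<and>
     (\<exists>e>0. \<forall>z\<in>ball zs e. (\<forall>i. g z $ i \<le> 0) \<longrightarrow> \<phi> zs \<le> \<phi> z)"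

definition multipliers :: "(real^'n \<Rightarrow> real) \<Rightarrow> (real^'n \<Rightarrow> real^'m) \<Rightarrow> real^'n \<Rightarrow> (real^'m) set" where
  "multipliers \<phi> g zs = {l. kkt \<phi> g zs l}"

(* The Euclidean distance from (z,l) to {zs} x multipliers; the norm on the product type is
   Euclidean. *)
definition solution_dist ::
    "(real^'n \<Rightarrow> real) \<Rightarrow> (real^'n \<Rightarrow> real^'m) \<Rightarrow> real^'n \<Rightarrow> real^'n \<Rightarrow> real^'m \<Rightarrow> real" where
  "solution_dist \<phi> g zs z l = infdist (z, l) ({zs} \<times> multipliers \<phi> g zs)"

definition active :: "(real^'n \<Rightarrow> real^'m) \<Rightarrow> real^'n \<Rightarrow> 'm set" where
  "active g zs = {i. g zs $ i = 0}"

definition active_plus :: "(real^'n \<Rightarrow> real) \<Rightarrow> (real^'n \<Rightarrow> real^'m) \<Rightarrow> real^'n \<Rightarrow> 'm set" where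
  "active_plus \<phi> g zs = {i \<in> active g zs. \<exists>l\<in>multipliers \<phi> g zs. 0 < l $ i}"

definition grad_component :: "(real^'n \<Rightarrow> real^'m) \<Rightarrow> 'm \<Rightarrow> real^'n \<Rightarrow> real^'n" where
  "grad_component g i z = gradient (\<lambda>x. g x $ i) z"

definition mfcq :: "(real^'n \<Rightarrow> real^'m) \<Rightarrow> real^'n \<Rightarrow> bool" where
  "mfcq g zs \<longleftrightarrow> (\<exists>y. \<forall>i\<in>active g zs. grad_component g i zs \<bullet> y < 0)"

definition second_order_condition ::
    "(real^'n \<Rightarrow> real) \<Rightarrow> (real^'n \<Rightarrow> real^'m) \<Rightarrow> real^'n \<Rightarrow> bool" where
  "second_order_condition \<phi> g zs \<longleftrightarrow>
     (\<exists>\<xi>>0. \<forall>l\<in>multipliers \<phi> g zs. \<forall>w.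
        (\<forall>i\<in>active_plus \<phi> g zs. grad_component g i zs \<bullet> w = 0) \<and>
        (\<forall>i\<in>active g zs - active_plus \<phi> g zs. grad_component g i zs \<bullet> w \<le> 0)
        \<longrightarrow> w \<bullet> (lagrangian_zz \<phi> g zs l *v w) \<ge> \<xi> * (norm w)^2)"

definition strict_complementarity ::
    "(real^'n \<Rightarrow> real) \<Rightarrow> (real^'n \<Rightarrow> real^'m) \<Rightarrow> real^'n \<Rightarrow> bool" where
  "strict_complementarity \<phi> g zs \<longleftrightarrow> (\<exists>l\<in>multipliers \<phi> g zs. \<forall>i\<in>active g zs. 0 < l $ i)"

definition duality_measure :: "real^'m \<Rightarrow> real^'m \<Rightarrow> real" where
  "duality_measure l s = l \<bullet> s / real CARD('m)"

definition iterate_conditions ::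
    "(real^'n \<Rightarrow> real) \<Rightarrow> (real^'n \<Rightarrow> real^'m) \<Rightarrow> real \<Rightarrow> real \<Rightarrow>
     real^'n \<Rightarrow> real^'m \<Rightarrow> real^'m \<Rightarrow> bool" where
  "iterate_conditions \<phi> g C \<gamma> z l s \<longleftrightarrow>
     norm (lagrangian_z \<phi> g z l) \<le> C * duality_measure l s \<and>
     norm (g z + s) \<le> C * duality_measure l s \<and>
     (\<forall>i. 0 < l $ i \<and> 0 < s $ i) \<and>
     (\<forall>i. l $ i * s $ i \<ge> \<gamma> * duality_measure l s)"

(* The index sets B (active) and N (inactive) may be empty, so they are not types: a vector
   indexed by a set I of constraints is a vector in real^'m that vanishes outside I, and a matrix
   with rows indexed by I and columns indexed by J is one that vanishes outside I x J. Euclidean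
   norms, operator norms and matrix products are unaffected by this padding with zeros. *)
definition vec_on :: "'a set \<Rightarrow> real^'a \<Rightarrow> bool" where
  "vec_on I x \<longleftrightarrow> (\<forall>i. i \<notin> I \<longrightarrow> x $ i = 0)"

definition mat_on :: "'a set \<Rightarrow> 'b set \<Rightarrow> real^'b^'a \<Rightarrow> bool" where
  "mat_on I J A \<longleftrightarrow> (\<forall>i j. i \<notin> I \<or> j \<notin> J \<longrightarrow> A $ i $ j = 0)"

definition grad_matrix :: "(real^'n \<Rightarrow> real^'m) \<Rightarrow> 'm set \<Rightarrow> real^'n \<Rightarrow> real^'m^'n" where
  "grad_matrix g I z = (\<chi> k i. if i \<in> I then grad_component g i z $ k else 0)"

definition ratio_matrix :: "'m set \<Rightarrow> real^'m \<Rightarrow> real^'m \<Rightarrow> real^'m^'m" where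
  "ratio_matrix I l s = (\<chi> i j. if i = j \<and> i \<in> I then inverse (l $ i) * s $ i else 0)"

abbreviation opnorm :: "real^'b^'a \<Rightarrow> real" where
  "opnorm A \<equiv> onorm ((*v) A)"

(* Orthogonal factors given by their columns. With n = CARD('n):
     Uhat = [p 0, ..., p (r-1)],   Vhat = [p r, ..., p (n-1)],
     U    = [q 0, ..., q (r-1)],   V    = [q r, ..., q (card I - 1)],
   Sigma = diag (\<sigma> 0, ..., \<sigma> (r-1)), and A = Uhat Sigma U^T, where the columns of A are indexed
   by I. Any of the four blocks may be empty. *)
definition svd_on ::
    "'m set \<Rightarrow> real^'m^'n \<Rightarrow> nat \<Rightarrow> (nat \<Rightarrow> real^'n) \<Rightarrow> (nat \<Rightarrow> real) \<Rightarrow> (nat \<Rightarrow> real^'m) \<Rightarrow> bool" where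
  "svd_on I A r p \<sigma> q \<longleftrightarrow>
     r \<le> CARD('n) \<and> r \<le> card I \<and>
     (\<forall>k<CARD('n). \<forall>j<CARD('n). p k \<bullet> p j = (if k = j then 1 else 0)) \<and>
     (\<forall>k<card I. vec_on I (q k)) \<and>
     (\<forall>k<card I. \<forall>j<card I. q k \<bullet> q j = (if k = j then 1 else 0)) \<and>
     (\<forall>k<r. 0 < \<sigma> k) \<and>
     A = (\<chi> i j. \<Sum>k<r. p k $ i * \<sigma> k * q k $ j)"

definition sv_matrix :: "nat \<Rightarrow> (nat \<Rightarrow> real) \<Rightarrow> real Matrix.mat" where
  "sv_matrix r \<sigma> = Matrix.mat r r (\<lambda>(i, j). if i = j then \<sigma> i else 0)"

(* Vhat^T H Vhat, for Vhat = [p r, ..., p (n-1)] as in svd_on. *)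
definition reduced_matrix :: "nat \<Rightarrow> (nat \<Rightarrow> real^'n) \<Rightarrow> real^'n^'n \<Rightarrow> real Matrix.mat" where
  "reduced_matrix r p H =
     Matrix.mat (CARD('n) - r) (CARD('n) - r) (\<lambda>(i, j). p (r + i) \<bullet> (H *v p (r + j)))"

(* The smallest eigenvalue of a symmetric matrix; the value is infinite for the 0 x 0 matrix,
   so that a lower bound on it is then no restriction. *)
definition sigma_min :: "real Matrix.mat \<Rightarrow> ereal" where
  "sigma_min A = (INF k\<in>{k. eigenvalue A k}. ereal k)"

(* Norms of U^T y and V^T y, for y indexed by I. *)
definition norm_Ut :: "nat \<Rightarrow> (nat \<Rightarrow> real^'m) \<Rightarrow> real^'m \<Rightarrow> real" where
  "norm_Ut r q y = L2_set (\<lambda>k. q k \<bullet> y) {..<r}"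

definition norm_Vt :: "'m set \<Rightarrow> nat \<Rightarrow> (nat \<Rightarrow> real^'m) \<Rightarrow> real^'m \<Rightarrow> real" where
  "norm_Vt I r q y = L2_set (\<lambda>k. q k \<bullet> y) {r..<card I}"

end

theory Submission
  imports Defs
begin

text \<open>
  Write \<open>A\<close> for the active constraint gradients at \<open>zs\<close>. By strict complementarity every active
  constraint carries a positive multiplier, so the second-order condition says that the Hessian of
  the Lagrangian is coercive on \<open>ker A\<^sup>T\<close>.

  Two estimates show that the iterate is within \<open>O(\<mu>)\<close> of \<open>zs\<close>. Pairing the gradient of the
  Lagrangian with the component of \<open>z - zs\<close> in \<open>ker A\<^sup>T\<close> bounds \<open>z - zs\<close> by \<open>\<mu>\<close> plus the active
  slacks; pairing it with \<open>z - zs\<close> itself, and comparing \<open>l\<close> with a strictly complementary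
  multiplier, bounds the active slacks by \<open>\<mu>\<close>. Together with \<open>l\<^sub>i s\<^sub>i \<ge> \<gamma> \<mu>\<close> this makes \<open>s\<^sub>i / l\<^sub>i\<close> of exact
  order \<open>\<mu>\<close> on the active and \<open>1 / \<mu>\<close> on the inactive constraints.

  In the linear system, \<open>w\<close> is split along \<open>range A\<close> and \<open>ker A\<^sup>T\<close>, and \<open>y\<close> along \<open>range A\<^sup>T\<close> and
  \<open>ker A\<close>. Pairing each block row with the matching components bounds each component by the others,
  with a small factor wherever the dependence is circular, and these inequalities can be
  solved for the norms. For a fixed problem, coercivity and the
  positive singular values of \<open>A\<close> already have positive lower bounds.
\<close>

section \<open>Block elimination in the perturbed system\<close>

text \<open>Measuring \<open>q\<close> and \<open>r7\<close> in units of \<mu> leaves two small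
  parameters, \<mu> and \<open>t\<close>. The perturbation of order u/\<mu>^2 is then harmless: it
  acts on a vector of size \<open>\<mu> * P\<close> next to a diagonal of order 1/\<mu>. To leading
  order the scalar system is triangular: \<open>WR\<close> depends on data only, \<open>WN\<close>
  on \<open>WR\<close>, \<open>YU\<close> on \<open>W\<close>, \<open>YV\<close> on \<open>W\<close>
  and \<open>YU\<close>, and \<open>P\<close> on \<open>W\<close>; every other coupling carries
  \<mu> or \<open>t\<close>. The mixed coefficients \<open>t + \<mu>\<close> arise because
  \<open>r8\<close> reaches \<open>YV\<close> through \<open>P\<close> and \<open>r7\<close> reaches
  \<open>P\<close> through \<open>YV\<close>, each with a factor \<open>t\<close>, while the \<mu>
  part travels through \<open>W\<close> and \<open>YU\<close>. The obstacle at the iterate is that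
  MFCQ leaves the multiplier non-unique, so the difference between \<open>l\<close> and a fixed
  multiplier is not small and can only be used inside inner products that cancel it or give it a
  sign. The two distance estimates are moreover circular: each returns the distance with a small
  factor \<open>\<omega>\<close>. It can be absorbed since \<open>\<omega>\<close> is chosen after
  all other constants.\<close>

text \<open>
  Here \<open>t\<close> stands for \<open>u / \<mu>\<close>, \<open>P\<close> for \<open>\<parallel>q\<parallel> / \<mu>\<close> and \<open>X\<close> for \<open>\<parallel>r7\<parallel> / \<mu>\<close>; \<open>WR\<close>, \<open>WN\<close> are the norms of the
  components of \<open>w\<close> in \<open>range A\<close> and \<open>ker A\<^sup>T\<close>, and \<open>YU\<close>, \<open>YV\<close> those of \<open>y\<close> in \<open>range A\<^sup>T\<close> and \<open>ker A\<close>.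
\<close>
lemma kkt_scalar_bounds:
  fixes N :: real
  assumes N: "1 \<le> N"
  shows "\<exists>\<delta>>0. \<exists>K\<ge>1. \<forall>\<mu> t W WR WN YU YV P X R5 R6 R8.
    0 < \<mu> \<and> \<mu> \<le> \<delta> \<and> 0 \<le> t \<and> t \<le> \<delta> \<and>
    0 \<le> W \<and> 0 \<le> WR \<and> 0 \<le> WN \<and> 0 \<le> YU \<and> 0 \<le> YV \<and> 0 \<le> P \<and> 0 \<le> X \<and> 0 \<le> R5 \<and> 0 \<le> R6 \<and> 0 \<le> R8 \<and>
    P \<le> N * (t * P + W + t * YU + t * YV + R8) \<and>
    YV \<le> N * (W + YU + t * YV + t * P + X) \<and>
    WR \<le> N * (R6 + \<mu> * X + \<mu> * W + \<mu> * YU + \<mu> * YV + \<mu> * P) \<and>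
    WN \<le> N * (WR + t * W + \<mu> * YU + \<mu> * YV + \<mu> * P + R5) \<and>
    YU \<le> N * (R5 + W + \<mu> * YU + \<mu> * YV + \<mu> * P) \<and>
    W \<le> WR + WN
    \<longrightarrow> YU \<le> K * (R5 + R6 + \<mu> * X + \<mu> * R8) \<and> W \<le> K * (R5 + R6 + \<mu> * X + \<mu> * R8) \<and>
        YV \<le> K * (R5 + R6 + X + (t + \<mu>) * R8) \<and>
        P \<le> K * (R5 + R6 + R8 + (t + \<mu>) * X)"
proof -
  \<comment> \<open>One constant per elimination: \<open>N2\<close> bounds \<open>YV\<close>,
    \<open>N3\<close> the sum of the \<mu>-weighted unknowns, \<open>N4\<close> bounds
    \<open>YU\<close>, \<open>N5\<close> that sum again without \<open>YU\<close>, \<open>N6\<close>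
    and \<open>N7\<close> bound \<open>WR\<close> and \<open>WN\<close>, \<open>J\<close> bounds
    \<open>W\<close>, and \<open>J1\<close> bounds \<open>W + YU\<close>. \<open>K\<close> adds up
    what back substitution produces.\<close>
  define N2 where "N2 = 4 * N\<^sup>2"
  define N3 where "N3 = N2 + 4 * N + 1"
  define N4 where "N4 = 2 * N * (1 + N3) + 2 * N + 1"
  define N5 where "N5 = N3 * (1 + N4)"
  define N6 where "N6 = N * (1 + N5)"
  define N7 where "N7 = N * (1 + N5 + N6)"
  define J where "J = 2 * (N6 + N7)"
  define J1 where "J1 = 1 + J + N4 * (1 + J)"
  define K where "K = J1 + N2 * (1 + J1) + 4 * N * (N2 + J1 + 1)"
  \<comment> \<open>Each entry pays for one absorption: \<open>1 / (4 * N)\<close> for the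
    occurrences of \<open>P\<close> and \<open>YV\<close> in their own rows, the next two for
    substituting \<open>P\<close> and \<open>YV\<close> into each other, then one for
    \<open>YU\<close> and the last for \<open>W\<close>.\<close>
  define \<delta> where "\<delta> = Min {1, 1 / (4 * N), 1 / (8 * N\<^sup>2), 1 / N2, 1 / (2 * N * N3), 1 / (2 * J)}"
  have pos: "1 \<le> N2" "1 \<le> N3" "1 \<le> N4" "1 \<le> N5" "1 \<le> N6" "1 \<le> N7" "1 \<le> J" "1 \<le> J1" "1 \<le> K"
  proof -
    have "1 * 1 \<le> N * N" by (rule mult_mono) (use N in auto)
    then show 2: "1 \<le> N2" by (simp add: N2_def power2_eq_square)
    then show 3: "1 \<le> N3" using N by (simp add: N3_def)
    have "0 \<le> N * N3" using 3 N by simp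
    then show 4: "1 \<le> N4" using N by (simp add: N4_def algebra_simps)
    have "1 * 1 \<le> N3 * (1 + N4)" by (rule mult_mono) (use 3 4 in auto)
    then show 5: "1 \<le> N5" by (simp add: N5_def)
    have "1 * 1 \<le> N * (1 + N5)" by (rule mult_mono) (use 5 N in auto)
    then show 6: "1 \<le> N6" by (simp add: N6_def)
    have "1 * 1 \<le> N * (1 + N5 + N6)" by (rule mult_mono) (use 5 6 N in auto)
    then show 7: "1 \<le> N7" by (simp add: N7_def)
    then show 8: "1 \<le> J" using 6 by (simp add: J_def)
    have "0 \<le> N4 * (1 + J)" using 4 8 by simp
    then show 9: "1 \<le> J1" using 8 by (simp add: J1_def)
    have "0 \<le> N2 * (1 + J1)" "0 \<le> 4 * N * (N2 + J1 + 1)" using 2 9 N by simp_all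
    then show "1 \<le> K" using 9 by (simp add: K_def)
  qed
  have \<delta>0: "\<delta> > 0" using N pos by (simp add: \<delta>_def)
  show ?thesis
  proof (rule exI[of _ \<delta>], rule conjI[OF \<delta>0], rule exI[of _ K], rule conjI[OF pos(9)], intro allI, rule impI, elim conjE)
    fix \<mu> t W WR WN YU YV P X R5 R6 R8 :: real
    assume \<mu>: "0 < \<mu>" "\<mu> \<le> \<delta>" and t: "0 \<le> t" "t \<le> \<delta>"
      and nn: "0 \<le> W" "0 \<le> WR" "0 \<le> WN" "0 \<le> YU" "0 \<le> YV" "0 \<le> P" "0 \<le> X" "0 \<le> R5" "0 \<le> R6" "0 \<le> R8"
      and P: "P \<le> N * (t * P + W + t * YU + t * YV + R8)"
      and YV: "YV \<le> N * (W + YU + t * YV + t * P + X)"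
      and WR: "WR \<le> N * (R6 + \<mu> * X + \<mu> * W + \<mu> * YU + \<mu> * YV + \<mu> * P)"
      and WN: "WN \<le> N * (WR + t * W + \<mu> * YU + \<mu> * YV + \<mu> * P + R5)"
      and YU: "YU \<le> N * (R5 + W + \<mu> * YU + \<mu> * YV + \<mu> * P)"
      and W: "W \<le> WR + WN"
    have \<delta>: "\<delta> \<le> 1" "\<delta> \<le> 1 / (4 * N)" "\<delta> \<le> 1 / (8 * N\<^sup>2)" "\<delta> \<le> 1 / N2" "\<delta> \<le> 1 / (2 * N * N3)" "\<delta> \<le> 1 / (2 * J)"
      by (simp_all add: \<delta>_def)
    have sm: "t \<le> 1" "\<mu> \<le> 1" "4 * N * t \<le> 1" "8 * N\<^sup>2 * t \<le> 1" "N2 * t \<le> 1" "2 * N * N3 * \<mu> \<le> 1"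
       "2 * J * \<mu> \<le> 1" "2 * J * t \<le> 1"
    proof -
      have *: "c * x \<le> 1" if "x \<le> \<delta>" "\<delta> \<le> 1 / c" "c > 0" for c x :: real
        using that by (metis dual_order.trans mult.commute pos_le_divide_eq)
      show "t \<le> 1" "\<mu> \<le> 1" using \<mu> t \<delta> by linarith+
      show "4 * N * t \<le> 1" "8 * N\<^sup>2 * t \<le> 1" "N2 * t \<le> 1"
        using *[OF t(2) \<delta>(2)] *[OF t(2) \<delta>(3)] *[OF t(2) \<delta>(4)] N pos by simp_all
      show "2 * N * N3 * \<mu> \<le> 1" "2 * J * \<mu> \<le> 1" "2 * J * t \<le> 1"
        using *[OF \<mu>(2) \<delta>(5)] *[OF \<mu>(2) \<delta>(6)] *[OF t(2) \<delta>(6)] N pos by simp_all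
    qed
    \<comment> \<open>The data as seen by \<open>W\<close> and \<open>YU\<close>;
      \<open>\<mu> * X\<close> is the norm of \<open>r7\<close>.\<close>
    define Z where "Z = R5 + R6 + \<mu> * X + \<mu> * R8"
    have nnp: "0 \<le> \<mu> * X" "0 \<le> \<mu> * R8" "0 \<le> \<mu> * W" "0 \<le> \<mu> * YU" "0 \<le> t * W" "0 \<le> t * R8" "0 \<le> t * X"
      "0 \<le> t * YU" "0 \<le> t * YV" "0 \<le> \<mu> * YV" "0 \<le> \<mu> * P"
      using \<mu> t nn by simp_all
    have Z0: "0 \<le> Z" using nn nnp by (simp add: Z_def)
    have NP: "N * (t * P) \<le> P / 4" using mult_right_mono[OF sm(3) nn(6)] by (simp add: algebra_simps)
    have P1: "P \<le> 2 * N * (W + t * YU + t * YV + R8)"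
      using P NP nn(6) by (simp add: algebra_simps)
    have YV1: "YV \<le> N2 * (W + YU + X + t * R8)"
    proof -
      have a: "N * (t * YV) \<le> YV / 4" using mult_right_mono[OF sm(3) nn(5)] by (simp add: algebra_simps)
      have "t * P \<le> t * (2 * N * (W + t * YU + t * YV + R8))"
        using P1 t by (simp add: mult_left_mono)
      then have "N * (t * P) \<le> N * (t * (2 * N * (W + t * YU + t * YV + R8)))"
        using N by (simp add: mult_left_mono)
      also have "\<dots> = (8 * N\<^sup>2 * t) * ((W + t * YU + t * YV) / 4) + 2 * N\<^sup>2 * (t * R8)"
        by (simp add: algebra_simps power2_eq_square)
      also have "\<dots> \<le> 1 * ((W + t * YU + t * YV) / 4) + 2 * N\<^sup>2 * (t * R8)"
        by (intro add_right_mono mult_right_mono sm) (use nn nnp in simp)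
      also have "\<dots> \<le> (W + YU + YV) / 4 + 2 * N\<^sup>2 * (t * R8)"
        using mult_right_mono[OF sm(1) nn(4)] mult_right_mono[OF sm(1) nn(5)] by simp
      finally have b: "N * (t * P) \<le> (W + YU + YV) / 4 + 2 * N\<^sup>2 * (t * R8)" .
      have NN: "N \<le> N\<^sup>2" using N by (simp add: power2_eq_square)
      have "YV \<le> 2 * N * (W + YU + X) + (W + YU) / 2 + 4 * N\<^sup>2 * (t * R8)"
        using YV a b by (simp add: algebra_simps add_divide_distrib)
      also have "\<dots> \<le> 2 * N\<^sup>2 * (W + YU + X) + N\<^sup>2 * (W + YU) + 4 * N\<^sup>2 * (t * R8)"
      proof -
        have "2 * N * (W + YU + X) \<le> 2 * N\<^sup>2 * (W + YU + X)"
          by (intro mult_right_mono) (use nn NN in auto)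
        moreover have "1 * (W + YU) \<le> N\<^sup>2 * (W + YU)"
          by (intro mult_right_mono) (use nn N in auto)
        ultimately show ?thesis using nn by (simp add: algebra_simps add_divide_distrib)
      qed
      also have "\<dots> \<le> N2 * (W + YU + X + t * R8)"
      proof -
        have "0 \<le> N\<^sup>2 * (W + YU + 2 * X)" using nn by simp
        then show ?thesis by (simp add: N2_def algebra_simps)
      qed
      finally show ?thesis .
    qed
    \<comment> \<open>\<open>X\<close> arrives here only through \<open>t * YV\<close>, which is why
      it carries the factor \<open>t\<close>.\<close>
    have P2: "P \<le> 4 * N * (W + YU + R8 + N2 * (t * X))"
    proof -
      have "t * YV \<le> t * (N2 * (W + YU + X + t * R8))" using YV1 t by (simp add: mult_left_mono)
      also have "\<dots> = (N2 * t) * (W + YU + t * R8) + N2 * (t * X)" by (simp add: algebra_simps)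
      also have "\<dots> \<le> 1 * (W + YU + t * R8) + N2 * (t * X)"
        by (intro add_right_mono mult_right_mono sm) (use nn nnp in simp)
      finally have "W + t * YU + t * YV + R8 \<le> 2 * (W + YU + R8 + N2 * (t * X))"
        using mult_right_mono[OF sm(1) nn(4)] mult_right_mono[OF sm(1) nn(10)] mult_nonneg_nonneg[OF _ nnp(7), of N2] pos nn
        by simp
      then have "2 * N * (W + t * YU + t * YV + R8) \<le> 2 * N * (2 * (W + YU + R8 + N2 * (t * X)))"
        using N by (intro mult_left_mono) auto
      then show ?thesis using P1 by (simp add: algebra_simps add_divide_distrib)
    qed
    \<comment> \<open>The remaining rows contain \<open>YV\<close> and \<open>P\<close> only with
      the weight \<mu>, so this sum is all that has to be eliminated from them. The three summands
      of \<open>N3\<close> stem from \<open>YV\<close>, \<open>P\<close> and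
      \<open>YU\<close>.\<close>
    have S: "\<mu> * YU + \<mu> * YV + \<mu> * P \<le> N3 * (\<mu> * W + \<mu> * YU + Z)"
    proof -
      have a: "\<mu> * YV \<le> \<mu> * (N2 * (W + YU + X + t * R8))" using YV1 \<mu> by (simp add: mult_left_mono)
      have "\<mu> * (t * R8) \<le> \<mu> * R8"
        using mult_left_mono[OF mult_right_mono[OF sm(1) nn(10)], of \<mu>] \<mu> by simp
      then have "\<mu> * (W + YU + X + t * R8) \<le> \<mu> * W + \<mu> * YU + Z"
        using nn by (simp add: Z_def distrib_left)
      then have b: "N2 * (\<mu> * (W + YU + X + t * R8)) \<le> N2 * (\<mu> * W + \<mu> * YU + Z)"
        using pos by (intro mult_left_mono) auto
      have c: "\<mu> * P \<le> \<mu> * (4 * N * (W + YU + R8 + N2 * (t * X)))" using P2 \<mu> by (simp add: mult_left_mono)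
      have "N2 * t * (\<mu> * X) \<le> 1 * (\<mu> * X)" by (intro mult_right_mono sm nnp)
      then have "\<mu> * (W + YU + R8 + N2 * (t * X)) \<le> \<mu> * W + \<mu> * YU + Z"
        using nn by (simp add: Z_def algebra_simps add_divide_distrib)
      then have "4 * N * (\<mu> * (W + YU + R8 + N2 * (t * X))) \<le> 4 * N * (\<mu> * W + \<mu> * YU + Z)"
        using N by (intro mult_left_mono) auto
      with a b c have "\<mu> * YU + \<mu> * YV + \<mu> * P
          \<le> \<mu> * YU + N2 * (\<mu> * W + \<mu> * YU + Z) + 4 * N * (\<mu> * W + \<mu> * YU + Z)"
        by (simp add: ac_simps)
      then show ?thesis using nnp Z0 by (simp add: N3_def algebra_simps)
    qed
    have YU1: "YU \<le> N4 * (Z + W)"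
    proof -
      have a: "N * (\<mu> * YU + \<mu> * YV + \<mu> * P) \<le> N * (N3 * (\<mu> * W + \<mu> * YU + Z))"
        using S N by (intro mult_left_mono) auto
      have b: "N * (N3 * (\<mu> * x)) \<le> x / 2" if "0 \<le> x" for x
        using mult_right_mono[OF sm(6) that] by (simp add: algebra_simps add_divide_distrib)
      have "N * R5 \<le> N * Z" using N nn nnp by (simp add: Z_def)
      then have "YU \<le> 2 * (N * Z) + 2 * (N * W) + W + 2 * (N * (N3 * Z))"
        using YU a b[OF nn(1)] b[OF nn(4)] by (simp add: algebra_simps add_divide_distrib)
      also have "\<dots> \<le> N4 * (Z + W)"
      proof -
        have "0 \<le> N * W" "0 \<le> N * Z" "0 \<le> N * (N3 * W)" using N nn pos Z0 by simp_all
        then show ?thesis using Z0 by (simp add: N4_def algebra_simps add_divide_distrib)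
      qed
      finally show ?thesis .
    qed
    have S2: "\<mu> * YU + \<mu> * YV + \<mu> * P \<le> N5 * (Z + \<mu> * W)"
    proof -
      have "\<mu> * YU \<le> \<mu> * (N4 * (Z + W))" using YU1 \<mu> by (intro mult_left_mono) auto
      also have "\<dots> = N4 * (\<mu> * Z) + N4 * (\<mu> * W)" by (simp add: algebra_simps)
      also have "N4 * (\<mu> * Z) \<le> N4 * Z"
        using mult_right_mono[OF sm(2) Z0] pos by (intro mult_left_mono) auto
      finally have "\<mu> * W + \<mu> * YU + Z \<le> (1 + N4) * (Z + \<mu> * W)" by (simp add: algebra_simps)
      then have "N3 * (\<mu> * W + \<mu> * YU + Z) \<le> N3 * ((1 + N4) * (Z + \<mu> * W))"
        using pos by (intro mult_left_mono) auto
      then show ?thesis using S by (simp add: N5_def mult.assoc)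
    qed
    have WR1: "WR \<le> N6 * (Z + \<mu> * W)"
    proof -
      have "R6 + \<mu> * X + \<mu> * W + \<mu> * YU + \<mu> * YV + \<mu> * P \<le> (1 + N5) * (Z + \<mu> * W)"
        using S2 nn nnp by (simp add: Z_def distrib_right)
      then have "N * (R6 + \<mu> * X + \<mu> * W + \<mu> * YU + \<mu> * YV + \<mu> * P) \<le> N * ((1 + N5) * (Z + \<mu> * W))"
        using N by (intro mult_left_mono) auto
      then show ?thesis using WR by (simp add: N6_def mult.assoc)
    qed
    have WN1: "WN \<le> N7 * (Z + \<mu> * W + t * W)"
    proof -
      have "0 \<le> N5 * (t * W)" "0 \<le> N6 * (t * W)" using pos nnp by simp_all
      then have "WR + t * W + \<mu> * YU + \<mu> * YV + \<mu> * P + R5 \<le> (1 + N5 + N6) * (Z + \<mu> * W + t * W)"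
        using S2 WR1 nn nnp by (simp add: Z_def distrib_right distrib_left)
      then have "N * (WR + t * W + \<mu> * YU + \<mu> * YV + \<mu> * P + R5) \<le> N * ((1 + N5 + N6) * (Z + \<mu> * W + t * W))"
        using N by (intro mult_left_mono) auto
      then show ?thesis using WN by (simp add: N7_def mult.assoc)
    qed
    \<comment> \<open>Doubling \<open>W\<close> leaves one half of it to absorb each of the \<mu>
      and \<open>t\<close> terms, with \<open>W\<close> itself remaining on the left.\<close>
    have W1: "W \<le> J * Z"
    proof -
      have "0 \<le> N6 * (t * W)" using pos nnp by simp
      then have "2 * W \<le> J * Z + J * (\<mu> * W) + J * (t * W)"
        using W WR1 WN1 by (simp add: J_def algebra_simps add_divide_distrib)
      moreover have "J * (\<mu> * W) \<le> W / 2" using mult_right_mono[OF sm(7) nn(1)] by (simp add: algebra_simps add_divide_distrib)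
      moreover have "J * (t * W) \<le> W / 2" using mult_right_mono[OF sm(8) nn(1)] by (simp add: algebra_simps add_divide_distrib)
      ultimately show ?thesis by (simp add: algebra_simps add_divide_distrib)
    qed
    have YU2: "YU \<le> N4 * (1 + J) * Z"
    proof -
      have "N4 * (Z + W) \<le> N4 * ((1 + J) * Z)"
        using W1 pos by (intro mult_left_mono) (auto simp: distrib_right)
      then show ?thesis using YU1 by (simp add: mult.assoc)
    qed
    have WYU: "W + YU \<le> J1 * Z" using W1 YU2 Z0 by (simp add: J1_def distrib_right)
    have J1K: "J1 \<le> K" "N2 * (1 + J1) \<le> K" "4 * N * (N2 + J1 + 1) \<le> K"
    proof -
      have "0 \<le> N2 * (1 + J1)" "0 \<le> 4 * N * (N2 + J1 + 1)" using N pos by simp_all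
      then show "J1 \<le> K" "N2 * (1 + J1) \<le> K" "4 * N * (N2 + J1 + 1) \<le> K"
        using pos unfolding K_def by linarith+
    qed
    have "J1 * Z \<le> K * Z" using J1K Z0 by (intro mult_right_mono) auto
    then have "YU \<le> K * Z" "W \<le> K * Z" using WYU nn(1,4) by simp_all
    then have c1: "YU \<le> K * (R5 + R6 + \<mu> * X + \<mu> * R8)" "W \<le> K * (R5 + R6 + \<mu> * X + \<mu> * R8)"
      by (simp_all only: Z_def)
    have muX: "\<mu> * X \<le> X" "\<mu> * R8 \<le> R8" using mult_right_mono[OF sm(2) nn(7)] mult_right_mono[OF sm(2) nn(10)] by simp_all
    have c2: "YV \<le> K * (R5 + R6 + X + (t + \<mu>) * R8)"
    proof -
      let ?Q = "R5 + R6 + X + (t + \<mu>) * R8"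
      have Q: "Z \<le> ?Q" "0 \<le> ?Q" using muX nn nnp by (simp_all add: Z_def distrib_right)
      have "J1 * Z \<le> J1 * ?Q" using Q(1) pos by (intro mult_left_mono) auto
      then have "W + YU + X + t * R8 \<le> (1 + J1) * ?Q"
        using WYU nn nnp by (simp add: distrib_right)
      then have "N2 * (W + YU + X + t * R8) \<le> N2 * ((1 + J1) * ?Q)"
        using pos by (intro mult_left_mono) auto
      also have "\<dots> \<le> K * ?Q" unfolding mult.assoc[symmetric] by (intro mult_right_mono J1K Q)
      finally show ?thesis using YV1 by linarith
    qed
    have c3: "P \<le> K * (R5 + R6 + R8 + (t + \<mu>) * X)"
    proof -
      let ?Q = "R5 + R6 + R8 + (t + \<mu>) * X"
      have Q: "Z \<le> ?Q" "0 \<le> ?Q" "R8 \<le> ?Q" "t * X \<le> ?Q" using muX nn nnp by (simp_all add: Z_def distrib_right)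
      have "J1 * Z \<le> J1 * ?Q" "N2 * (t * X) \<le> N2 * ?Q" using Q pos by (auto intro!: mult_left_mono)
      then have "W + YU + R8 + N2 * (t * X) \<le> (N2 + J1 + 1) * ?Q"
        using WYU Q(3) by (simp add: distrib_right)
      then have "4 * N * (W + YU + R8 + N2 * (t * X)) \<le> 4 * N * ((N2 + J1 + 1) * ?Q)"
        using N by (intro mult_left_mono) auto
      also have "\<dots> \<le> K * ?Q" unfolding mult.assoc[symmetric] by (intro mult_right_mono J1K Q)
      finally show ?thesis using P2 by linarith
    qed
    show "YU \<le> K * (R5 + R6 + \<mu> * X + \<mu> * R8) \<and> W \<le> K * (R5 + R6 + \<mu> * X + \<mu> * R8) \<and>
        YV \<le> K * (R5 + R6 + X + (t + \<mu>) * R8) \<and>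
        P \<le> K * (R5 + R6 + R8 + (t + \<mu>) * X)"
      by (intro conjI c1 c2 c3)
  qed
qed

section \<open>Operator norms and splittings along range and kernel\<close>

lemma norm_matrix_vector_mult_le:
  fixes A :: "real^'b^'a"
  assumes "opnorm A \<le> e"
  shows "norm (A *v x) \<le> e * norm x"
proof -
  have "norm (A *v x) \<le> opnorm A * norm x" by (rule onorm) simp
  also have "\<dots> \<le> e * norm x" by (intro mult_right_mono assms) simp
  finally show ?thesis .
qed

text \<open>Cauchy-Schwarz on the squared norm of the image, written as the inner product of
  \<open>x\<close> with \<open>A\<close> applied to that image; one factor of the norm
  cancels.\<close>

lemma norm_transpose_vector_mult_le:
  fixes A :: "real^'b^'a"
  assumes "opnorm A \<le> e"
  shows "norm (transpose A *v x) \<le> e * norm x"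
proof (cases "transpose A *v x = 0")
  case True
  have "0 \<le> opnorm A" by (rule onorm_pos_le) simp
  then show ?thesis using True assms by simp
next
  case False
  let ?y = "transpose A *v x"
  have "norm ?y * norm ?y = x \<bullet> (A *v ?y)"
    by (metis dot_lmul_matrix norm_eq_square power2_eq_square power2_norm_eq_inner transpose_matrix_vector)
  also have "\<dots> \<le> norm x * norm (A *v ?y)" by (rule norm_cauchy_schwarz)
  also have "\<dots> \<le> norm x * (e * norm ?y)"
    by (intro mult_left_mono norm_matrix_vector_mult_le assms) simp
  finally have "norm ?y * norm ?y \<le> (e * norm x) * norm ?y" by (simp add: mult_ac)
  then show ?thesis using False by simp
qed

lemma inner_transpose_mult: "x \<bullet> (transpose A *v y) = (A *v x) \<bullet> y" for A :: "real^'b^'a"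
  by (metis dot_lmul_matrix inner_commute transpose_matrix_vector)

text \<open>The transpose is injective on the range: if \<open>x = A *v v\<close> and A^T x = 0,
  then x is orthogonal to itself. An injective linear map on a finite-dimensional subspace is
  bounded below. For a nonzero matrix the best constant is the reciprocal of the smallest positive
  singular value.\<close>

lemma norm_le_on_range:
  fixes A :: "real^'b^'a"
  shows "\<exists>M. \<forall>x\<in>range ((*v) A). norm x \<le> M * norm (transpose A *v x)"
proof -
  let ?S = "range ((*v) A)"
  have sub: "subspace ?S" by (simp add: subspace_UNIV linear_subspace_image)
  have "\<exists>e>0. \<forall>x\<in>?S. e * norm x \<le> norm (transpose A *v x)"
  proof (rule injective_imp_isometric)
    show "closed ?S" using sub by (rule closed_subspace)
    show "\<forall>x\<in>?S. transpose A *v x = 0 \<longrightarrow> x = 0"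
    proof (intro ballI impI)
      fix x assume "x \<in> ?S" and 0: "transpose A *v x = 0"
      then obtain v where "x = A *v v" by auto
      then have "x \<bullet> x = v \<bullet> (transpose A *v x)" by (simp only: inner_transpose_mult)
      then show "x = 0" using 0 by simp
    qed
  qed (use sub in \<open>simp_all del: transpose_matrix_vector\<close>)
  then obtain e where e: "e > 0" "\<forall>x\<in>?S. e * norm x \<le> norm (transpose A *v x)" by blast
  have "norm x \<le> 1 / e * norm (transpose A *v x)" if "x \<in> ?S" for x
    using bspec[OF e(2) that] e(1) by (simp add: field_simps del: transpose_matrix_vector)
  then show ?thesis by blast
qed

text \<open>The orthogonal complement of the range is the kernel of the transpose.\<close>

lemma range_kernel_decomposition:
  fixes A :: "real^'b^'a"
  obtains xr xn where "x = xr + xn" "xr \<in> range ((*v) A)" "transpose A *v xn = 0"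
proof -
  let ?S = "range ((*v) A)"
  have sub: "subspace ?S" by (simp add: subspace_UNIV linear_subspace_image)
  obtain xr xn where x: "xr \<in> span ?S" "\<And>w. w \<in> span ?S \<Longrightarrow> Linear_Algebra.orthogonal xn w" "x = xr + xn"
    using orthogonal_subspace_decomp_exists[of ?S x] by metis
  have "v \<bullet> (transpose A *v xn) = 0" for v
    unfolding inner_transpose_mult using x(2)[of "A *v v"] by (simp add: Linear_Algebra.orthogonal_def inner_commute span_base)
  then have "transpose A *v xn = 0" by (metis inner_eq_zero_iff)
  moreover have "xr \<in> ?S" using x(1) sub by (metis span_eq_iff)
  ultimately show ?thesis using x(3) that by blast
qed

text \<open>After Cauchy-Schwarz one factor \<open>norm x\<close> cancels. The factor
  \<open>c\<close> stays on the left because it is \<mu> itself for the active diagonal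
  block.\<close>

lemma coercive_imp_norm_le:
  fixes x :: "'a::real_inner"
  assumes "c * (norm x)\<^sup>2 \<le> M * (x \<bullet> r)" "norm r \<le> e" "0 \<le> M" "0 \<le> e"
  shows "c * norm x \<le> M * e"
proof (cases "x = 0")
  case False
  have "x \<bullet> r \<le> norm x * e"
    using norm_cauchy_schwarz[of x r] assms(2) by (meson mult_left_mono norm_ge_zero order_trans)
  then have "M * (x \<bullet> r) \<le> M * (norm x * e)" using assms(3) by (rule mult_left_mono)
  then have "(c * norm x) * norm x \<le> (M * e) * norm x"
    using assms(1) by (simp add: power2_eq_square mult_ac)
  then show ?thesis using False by simp
qed (use assms in simp)


section \<open>Norm inequalities from the three block rows\<close>

text \<open>Two bounds pair a row with a kernel component, so that a term without usable bound drops
  out: \<open>A *v y\<close> of the first row against \<open>wn\<close>, and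
  \<open>transpose A *v (w - r6)\<close> of the second against \<open>yv\<close>. The other three
  solve a row for \<open>DN *v q\<close>, \<open>transpose A *v wr\<close> or
  \<open>A *v yu\<close>, which dominate \<open>q\<close>, \<open>wr\<close> and \<open>yu\<close>
  by hypothesis.\<close>

lemma kkt_estimates:
  fixes A G E12 :: "real^'m^'n" and GN E13 :: "real^'l^'n" and H E11 :: "real^'n^'n"
    and DB E22 :: "real^'m^'m" and E23 :: "real^'l^'m" and E31 :: "real^'n^'l"
    and E21 :: "real^'n^'m" and E32 :: "real^'m^'l" and DN E33 :: "real^'l^'l"
    and M \<mu> t :: real
  defines "N \<equiv> 3 * M\<^sup>2"
  assumes M: "1 \<le> M" and \<mu>: "0 < \<mu>" "\<mu> \<le> 1" and t: "0 \<le> t" "t \<le> 1"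
    and A: "opnorm A \<le> M" and G: "opnorm (G - A) \<le> M * \<mu>" and GN: "opnorm GN \<le> M"
    and H: "opnorm H \<le> M" and DB: "opnorm DB \<le> M * \<mu>"
    and E11: "opnorm E11 \<le> M * t" and E33: "opnorm E33 \<le> M * t / \<mu>"
    and E12: "opnorm E12 \<le> M * (t * \<mu>)" and E21: "opnorm E21 \<le> M * (t * \<mu>)"
    and E22: "opnorm E22 \<le> M * (t * \<mu>)"
    and E13: "opnorm E13 \<le> M * t" and E31: "opnorm E31 \<le> M * t"
    and E23: "opnorm E23 \<le> M * t" and E32: "opnorm E32 \<le> M * t"
    and wr: "norm wr \<le> M * norm (transpose A *v wr)"
    and wn: "transpose A *v wn = 0" "(norm wn)\<^sup>2 \<le> M * (wn \<bullet> (H *v wn))"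
    and yu: "norm yu \<le> M * norm (A *v yu)"
    and yv: "A *v yv = 0" "\<mu> * (norm yv)\<^sup>2 \<le> M * (yv \<bullet> (DB *v yv))"
    and q: "norm q \<le> M * \<mu> * norm (DN *v q)"
    and w_eq: "w = wr + wn" and y_eq: "y = yu + yv"
    and row1: "(H + E11) *v w + (G + E12) *v y + (GN + E13) *v q = r5"
    and row2: "(transpose G + E21) *v w + (- DB + E22) *v y + E23 *v q = transpose A *v r6 + r7"
    and row3: "(transpose GN + E31) *v w + E32 *v y + (- DN + E33) *v q = r8"
  shows "norm q / \<mu> \<le> N * (t * (norm q / \<mu>) + norm w + t * norm yu + t * norm yv + norm r8)"
    and "norm yv \<le> N * (norm w + norm yu + t * norm yv + t * (norm q / \<mu>) + norm r7 / \<mu>)"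
    and "norm wr \<le> N * (norm r6 + \<mu> * (norm r7 / \<mu>) + \<mu> * norm w + \<mu> * norm yu + \<mu> * norm yv
                        + \<mu> * (norm q / \<mu>))"
    and "norm wn \<le> N * (norm wr + t * norm w + \<mu> * norm yu + \<mu> * norm yv + \<mu> * (norm q / \<mu>) + norm r5)"
    and "norm yu \<le> N * (norm r5 + norm w + \<mu> * norm yu + \<mu> * norm yv + \<mu> * (norm q / \<mu>))"
proof -
  note le = norm_matrix_vector_mult_le and tle = norm_transpose_vector_mult_le
  define P where "P = norm q / \<mu>"
  have nq: "norm q = \<mu> * P" using \<mu> by (simp add: P_def)
  define X where "X = norm r7 / \<mu>"
  have nr7: "norm r7 = \<mu> * X" using \<mu> by (simp add: X_def)
  have P0: "0 \<le> P" "0 \<le> X" using \<mu> by (simp_all add: P_def X_def)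
  have ny: "norm y \<le> norm yu + norm yv" unfolding y_eq by (rule norm_triangle_ineq)
  let ?W = "norm w" and ?Y = "norm yu + norm yv"
  have M0: "0 \<le> M" using M by simp
  have tmu: "t * \<mu> \<le> \<mu>" "t * \<mu> \<le> t" using t \<mu> by (simp_all add: mult_le_one mult_left_le mult_left_le_one_le)
  have sc: "t * x \<le> x" "\<mu> * x \<le> x" "t * (\<mu> * x) \<le> \<mu> * x" "t * (\<mu> * x) \<le> t * x" "0 \<le> t * x" "0 \<le> \<mu> * x"
    if "0 \<le> x" for x
    using that t \<mu> tmu by (simp_all add: mult_left_le_one_le mult_left_mono)
  have expand1: "H *v w + E11 *v w + G *v y + E12 *v y + GN *v q + E13 *v q = r5"
    using row1 by (simp add: matrix_vector_mult_add_rdistrib add.assoc)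
  have expand2: "transpose G *v w + E21 *v w - DB *v y + E22 *v y + E23 *v q = transpose A *v r6 + r7"
    using row2 by (simp add: matrix_vector_mult_add_rdistrib matrix_vector_mult_diff_rdistrib algebra_simps)
  have expand3: "transpose GN *v w + E31 *v w + E32 *v y - DN *v q + E33 *v q = r8"
    using row3 by (simp add: matrix_vector_mult_add_rdistrib matrix_vector_mult_diff_rdistrib algebra_simps)
  have msc: "M * (t * x) \<le> M * x" "M * (t * (\<mu> * x)) \<le> M * (\<mu> * x)" "M * (t * (\<mu> * x)) \<le> M * (t * x)"
      "0 \<le> M * x" "x \<le> M * x" "0 \<le> M * (t * x)" "0 \<le> M * (\<mu> * x)" "\<mu> * x \<le> M * (\<mu> * x)" "M * (\<mu> * x) \<le> M * x"
    if "0 \<le> x" for x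
    using sc[OF that] M M0 that by (auto intro!: mult_left_mono simp: mult_le_cancel_right1)
  \<comment> \<open>One factor \<open>M\<close> inverts the leading operator, the other bounds the
    coefficients of the remaining terms; the 3 leaves room for merging terms of equal order.\<close>
  have fin: "x \<le> N * T" if "x \<le> M * i" "i \<le> 3 * (M * T)" for x i T
  proof -
    have "M * i \<le> M * (3 * (M * T))" using that(2) M0 by (rule mult_left_mono)
    then show ?thesis using that(1) by (simp add: N_def power2_eq_square)
  qed
  have yb: "norm (E *v y) \<le> c * norm yu + c * norm yv" if "opnorm E \<le> c" for E :: "real^'m^'k" and c
  proof -
    have "0 \<le> opnorm E" by (rule onorm_pos_le) simp
    then have "c * norm y \<le> c * (norm yu + norm yv)" using that ny by (intro mult_left_mono) auto
    then show ?thesis using le[OF that, of y] by (simp add: distrib_left)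
  qed
  have qb: "norm (E *v q) \<le> c * (\<mu> * P)" if "opnorm E \<le> c" for E :: "real^'l^'k" and c
    using le[OF that, of q] by (simp add: nq)
  have Gt: "norm (transpose (G - A) *v w) \<le> M * \<mu> * norm w" by (rule tle[OF G])
  have Ge: "transpose G *v w = transpose (G - A) *v w + transpose A *v w"
    and Gy: "G *v y = (G - A) *v y + A *v y"
    by (simp_all add: matrix_vector_mult_diff_rdistrib vector_matrix_mult_diff_rdistrib)
  have Aw: "transpose A *v w = transpose A *v wr" by (simp only: w_eq matrix_vector_right_distrib wn(1) add_0_right)
  have Ay: "A *v y = A *v yu" by (simp add: y_eq matrix_vector_right_distrib yv(1))
  show "norm q / \<mu> \<le> N * (t * (norm q / \<mu>) + norm w + t * norm yu + t * norm yv + norm r8)"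
    unfolding P_def[symmetric]
  proof (rule fin)
    let ?i = "M * norm w + M * t * norm w + (M * t * norm yu + M * t * norm yv) + M * t * P + norm r8"
    have eq: "DN *v q = transpose GN *v w + E31 *v w + E32 *v y + E33 *v q - r8"
      using expand3 by (simp add: algebra_simps)
    have "norm (DN *v q) \<le> norm (transpose GN *v w) + norm (E31 *v w) + norm (E32 *v y) + norm (E33 *v q) + norm r8"
      unfolding eq by norm
    then have "norm (DN *v q) \<le> ?i"
      using tle[OF GN, of w] le[OF E31, of w] yb[OF E32] qb[OF E33] \<mu> by simp
    then have "M * \<mu> * norm (DN *v q) \<le> M * \<mu> * ?i"
      using M0 \<mu> by (intro mult_left_mono) auto
    then have "\<mu> * P \<le> \<mu> * (M * ?i)" using q nq by (simp add: mult_ac)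
    then show "P \<le> M * ?i" using \<mu> by simp
    show "?i \<le> 3 * (M * (t * P + norm w + t * norm yu + t * norm yv + norm r8))"
      using msc[OF P0(1)] msc[OF norm_ge_zero[of w]] msc[OF norm_ge_zero[of yu]] msc[OF norm_ge_zero[of yv]]
       msc[OF norm_ge_zero[of r8]] by (simp add: algebra_simps)
  qed
  show "norm yv \<le> N * (norm w + norm yu + t * norm yv + t * (norm q / \<mu>) + norm r7 / \<mu>)"
    unfolding P_def[symmetric] X_def[symmetric]
  proof (rule fin)
    let ?i = "M * norm w + M * t * norm w + M * norm yu + (M * t * norm yu + M * t * norm yv) + M * t * P + X"
    let ?r = "transpose (G - A) *v w + E21 *v w - DB *v yu + E22 *v y + E23 *v q - r7"
    have "DB *v yv = ?r + (transpose A *v (w - r6))"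
      using expand2 unfolding Ge by (simp add: y_eq algebra_simps)
    moreover have "yv \<bullet> (transpose A *v (w - r6)) = 0"
      by (simp only: inner_transpose_mult yv(1) inner_zero_left)
    ultimately have "yv \<bullet> (DB *v yv) = yv \<bullet> ?r" by (simp only: inner_add_right)
    with yv(2) have 1: "\<mu> * (norm yv)\<^sup>2 \<le> M * (yv \<bullet> ?r)" by (simp only:)
    have "norm ?r \<le> norm (transpose (G - A) *v w) + norm (E21 *v w) + norm (DB *v yu) + norm (E22 *v y)
        + norm (E23 *v q) + norm r7" by norm
    also have "\<dots> \<le> M * \<mu> * norm w + M * (t * \<mu>) * norm w + M * \<mu> * norm yu
        + (M * (t * \<mu>) * norm yu + M * (t * \<mu>) * norm yv) + M * t * (\<mu> * P) + \<mu> * X"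
      using Gt le[OF E21, of w] le[OF DB, of yu] yb[OF E22] qb[OF E23] nr7 by simp
    also have "\<dots> = \<mu> * ?i" by (simp add: algebra_simps)
    finally have 2: "norm ?r \<le> \<mu> * ?i" .
    have "0 \<le> ?i" using M0 t P0 by simp
    then have "\<mu> * norm yv \<le> M * (\<mu> * ?i)"
      using \<mu> by (intro coercive_imp_norm_le[OF 1 2 M0]) simp
    then have "\<mu> * norm yv \<le> \<mu> * (M * ?i)" by (simp only: mult_ac)
    then show "norm yv \<le> M * ?i" using \<mu> by simp
    show "?i \<le> 3 * (M * (norm w + norm yu + t * norm yv + t * P + X))"
      using msc[OF P0(1)] msc[OF P0(2)] msc[OF norm_ge_zero[of w]] msc[OF norm_ge_zero[of yu]]
        msc[OF norm_ge_zero[of yv]] by (simp add: algebra_simps)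
  qed
  show "norm wr \<le> N * (norm r6 + \<mu> * (norm r7 / \<mu>) + \<mu> * norm w + \<mu> * norm yu + \<mu> * norm yv
                        + \<mu> * (norm q / \<mu>))"
    unfolding P_def[symmetric] X_def[symmetric]
  proof (rule fin)
    let ?i = "M * norm r6 + \<mu> * X + M * \<mu> * norm w + M * (t * \<mu>) * norm w + (M * \<mu> * norm yu + M * \<mu> * norm yv)
        + (M * (t * \<mu>) * norm yu + M * (t * \<mu>) * norm yv) + M * t * (\<mu> * P)"
    have eq: "transpose A *v wr = transpose A *v r6 + r7 - transpose (G - A) *v w - E21 *v w + DB *v y
        - E22 *v y - E23 *v q"
      using expand2 unfolding Ge Aw by (simp add: algebra_simps)
    have "norm (transpose A *v wr) \<le> norm (transpose A *v r6) + norm r7 + norm (transpose (G - A) *v w)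
        + norm (E21 *v w) + norm (DB *v y) + norm (E22 *v y) + norm (E23 *v q)"
      unfolding eq by norm
    also have "\<dots> \<le> ?i"
      using tle[OF A, of r6] Gt le[OF E21, of w] yb[OF DB] yb[OF E22] qb[OF E23] nr7 by simp
    finally have "M * norm (transpose A *v wr) \<le> M * ?i" using M0 by (rule mult_left_mono)
    then show "norm wr \<le> M * ?i" using wr by linarith
    show "?i \<le> 3 * (M * (norm r6 + \<mu> * X + \<mu> * norm w + \<mu> * norm yu + \<mu> * norm yv + \<mu> * P))"
      using msc[OF P0(1)] msc[OF P0(2)] msc[OF norm_ge_zero[of w]] msc[OF norm_ge_zero[of yu]]
        msc[OF norm_ge_zero[of yv]] msc[OF norm_ge_zero[of r6]] by (simp add: algebra_simps)
  qed
  show "norm wn \<le> N * (norm wr + t * norm w + \<mu> * norm yu + \<mu> * norm yv + \<mu> * (norm q / \<mu>) + norm r5)"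
    unfolding P_def[symmetric]
  proof (rule fin)
    let ?i = "norm r5 + M * norm wr + M * t * norm w + (M * \<mu> * norm yu + M * \<mu> * norm yv)
        + (M * (t * \<mu>) * norm yu + M * (t * \<mu>) * norm yv) + M * (\<mu> * P) + M * t * (\<mu> * P)"
    let ?r = "r5 - H *v wr - E11 *v w - (G - A) *v y - E12 *v y - GN *v q - E13 *v q"
    have "H *v wn = ?r - A *v y"
      using expand1 unfolding Gy by (simp add: w_eq algebra_simps)
    moreover have "wn \<bullet> (A *v y) = 0"
      using inner_transpose_mult[of y A wn] wn(1) by (simp add: inner_commute del: transpose_matrix_vector)
    ultimately have "wn \<bullet> (H *v wn) = wn \<bullet> ?r" by (simp only: inner_diff_right diff_0_right)
    with wn(2) have 1: "1 * (norm wn)\<^sup>2 \<le> M * (wn \<bullet> ?r)" by (simp only: mult_1_left)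
    have "norm ?r \<le> norm r5 + norm (H *v wr) + norm (E11 *v w) + norm ((G - A) *v y) + norm (E12 *v y)
        + norm (GN *v q) + norm (E13 *v q)" by norm
    also have "\<dots> \<le> ?i"
      using le[OF H, of wr] le[OF E11, of w] yb[OF G] yb[OF E12] qb[OF GN] qb[OF E13] by simp
    finally have 2: "norm ?r \<le> ?i" .
    have "0 \<le> ?i" using M0 t P0 \<mu> by simp
    from coercive_imp_norm_le[OF 1 2 M0 this] show "norm wn \<le> M * ?i" by simp
    show "?i \<le> 3 * (M * (norm wr + t * norm w + \<mu> * norm yu + \<mu> * norm yv + \<mu> * P + norm r5))"
      using msc[OF P0(1)] msc[OF norm_ge_zero[of w]] msc[OF norm_ge_zero[of wr]] msc[OF norm_ge_zero[of yu]]
        msc[OF norm_ge_zero[of yv]] msc[OF norm_ge_zero[of r5]] by (simp add: algebra_simps)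
  qed
  show "norm yu \<le> N * (norm r5 + norm w + \<mu> * norm yu + \<mu> * norm yv + \<mu> * (norm q / \<mu>))"
    unfolding P_def[symmetric]
  proof (rule fin)
    let ?i = "norm r5 + M * norm w + M * t * norm w + (M * \<mu> * norm yu + M * \<mu> * norm yv)
        + (M * (t * \<mu>) * norm yu + M * (t * \<mu>) * norm yv) + M * (\<mu> * P) + M * t * (\<mu> * P)"
    have eq: "A *v yu = r5 - H *v w - E11 *v w - (G - A) *v y - E12 *v y - GN *v q - E13 *v q"
      using expand1 unfolding Gy Ay by (simp add: algebra_simps)
    have "norm (A *v yu) \<le> norm r5 + norm (H *v w) + norm (E11 *v w) + norm ((G - A) *v y)
        + norm (E12 *v y) + norm (GN *v q) + norm (E13 *v q)" unfolding eq by norm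
    also have "\<dots> \<le> ?i"
      using le[OF H, of w] le[OF E11, of w] yb[OF G] yb[OF E12] qb[OF GN] qb[OF E13] by simp
    finally have "M * norm (A *v yu) \<le> M * ?i" using M0 by (rule mult_left_mono)
    then show "norm yu \<le> M * ?i" using yu by linarith
    show "?i \<le> 3 * (M * (norm r5 + norm w + \<mu> * norm yu + \<mu> * norm yv + \<mu> * P))"
      using msc[OF P0(1)] msc[OF norm_ge_zero[of w]] msc[OF norm_ge_zero[of yu]]
        msc[OF norm_ge_zero[of yv]] msc[OF norm_ge_zero[of r5]] by (simp add: algebra_simps)
  qed
qed

text \<open>\<open>A\<close> and \<open>M\<close> are fixed before \<open>\<delta>\<close> and
  \<open>K\<close> are chosen, so these may depend on the lower bounds for \<open>A\<close> and its
  transpose on each other's range. Writing the roundoff as \<open>t * \<mu>\<close> gives every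
  perturbation a size in the two small parameters.\<close>

lemma perturbed_kkt_bounds:
  fixes A :: "real^'m^'n" and M :: real
  assumes M: "1 \<le> M"
  shows "\<exists>\<delta>>0. \<exists>K\<ge>1. \<forall>\<mu> t (G :: real^'m^'n) (GN :: real^'l^'n) (H :: real^'n^'n)
      (DB :: real^'m^'m) (DN :: real^'l^'l) (E11 :: real^'n^'n) (E12 :: real^'m^'n) (E13 :: real^'l^'n)
      (E21 :: real^'n^'m) (E22 :: real^'m^'m) (E23 :: real^'l^'m)
      (E31 :: real^'n^'l) (E32 :: real^'m^'l) (E33 :: real^'l^'l) w yu yv q r5 r6 r7 r8.
    0 < \<mu> \<and> \<mu> \<le> \<delta> \<and> 0 \<le> t \<and> t \<le> \<delta> \<and>
    opnorm (G - A) \<le> M * \<mu> \<and> opnorm GN \<le> M \<and> opnorm H \<le> M \<and> opnorm DB \<le> M * \<mu> \<and>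
    opnorm E11 \<le> M * t \<and> opnorm E33 \<le> M * t / \<mu> \<and>
    opnorm E12 \<le> M * (t * \<mu>) \<and> opnorm E21 \<le> M * (t * \<mu>) \<and> opnorm E22 \<le> M * (t * \<mu>) \<and>
    opnorm E13 \<le> M * t \<and> opnorm E31 \<le> M * t \<and> opnorm E23 \<le> M * t \<and> opnorm E32 \<le> M * t \<and>
    (\<forall>x. transpose A *v x = 0 \<longrightarrow> (norm x)\<^sup>2 \<le> M * (x \<bullet> (H *v x))) \<and>
    yu \<in> range ((*v) (transpose A)) \<and> A *v yv = 0 \<and> \<mu> * (norm yv)\<^sup>2 \<le> M * (yv \<bullet> (DB *v yv)) \<and>
    norm q \<le> M * \<mu> * norm (DN *v q) \<and>
    (H + E11) *v w + (G + E12) *v (yu + yv) + (GN + E13) *v q = r5 \<and>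
    (transpose G + E21) *v w + (- DB + E22) *v (yu + yv) + E23 *v q = transpose A *v r6 + r7 \<and>
    (transpose GN + E31) *v w + E32 *v (yu + yv) + (- DN + E33) *v q = r8
    \<longrightarrow> norm yu \<le> K * (norm r5 + norm r6 + norm r7 + \<mu> * norm r8) \<and>
        norm w \<le> K * (norm r5 + norm r6 + norm r7 + \<mu> * norm r8) \<and>
        norm yv \<le> K * (norm r5 + norm r6 + norm r7 / \<mu> + (t + \<mu>) * norm r8) \<and>
        norm q \<le> K * \<mu> * (norm r5 + norm r6 + norm r8) + K * (t + \<mu>) * norm r7"
proof -
  obtain c1 where c1: "\<And>x. x \<in> range ((*v) A) \<Longrightarrow> norm x \<le> c1 * norm (transpose A *v x)"
    using norm_le_on_range[of A] by blast
  obtain c2 where c2: "\<And>x. x \<in> range ((*v) (transpose A)) \<Longrightarrow> norm x \<le> c2 * norm (A *v x)"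
    using norm_le_on_range[of "transpose A"] by (auto simp del: transpose_matrix_vector)
  define L where "L = Max {M, c1, c2, opnorm A}"
  have L: "M \<le> L" "c1 \<le> L" "c2 \<le> L" "opnorm A \<le> L" "1 \<le> L" using M by (auto simp: L_def)
  define N where "N = 3 * L\<^sup>2"
  have N: "1 \<le> N" using L(5) self_le_power[of L 2] by (simp add: N_def)
  obtain \<delta> K where \<delta>: "\<delta> > 0" and K: "K \<ge> 1" and scal: "\<And>\<mu> t W WR WN YU YV P X R5 R6 R8.
    0 < \<mu> \<and> \<mu> \<le> \<delta> \<and> 0 \<le> t \<and> t \<le> \<delta> \<and>
    0 \<le> W \<and> 0 \<le> WR \<and> 0 \<le> WN \<and> 0 \<le> YU \<and> 0 \<le> YV \<and> 0 \<le> P \<and> 0 \<le> X \<and> 0 \<le> R5 \<and> 0 \<le> R6 \<and> 0 \<le> R8 \<and>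
    P \<le> N * (t * P + W + t * YU + t * YV + R8) \<and>
    YV \<le> N * (W + YU + t * YV + t * P + X) \<and>
    WR \<le> N * (R6 + \<mu> * X + \<mu> * W + \<mu> * YU + \<mu> * YV + \<mu> * P) \<and>
    WN \<le> N * (WR + t * W + \<mu> * YU + \<mu> * YV + \<mu> * P + R5) \<and>
    YU \<le> N * (R5 + W + \<mu> * YU + \<mu> * YV + \<mu> * P) \<and>
    W \<le> WR + WN
    \<Longrightarrow> YU \<le> K * (R5 + R6 + \<mu> * X + \<mu> * R8) \<and> W \<le> K * (R5 + R6 + \<mu> * X + \<mu> * R8) \<and>
        YV \<le> K * (R5 + R6 + X + (t + \<mu>) * R8) \<and>
        P \<le> K * (R5 + R6 + R8 + (t + \<mu>) * X)"
    using kkt_scalar_bounds[OF N] by blast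
  show ?thesis
  proof (rule exI[of _ "min \<delta> 1"], rule conjI, use \<delta> in simp, rule exI[of _ K], rule conjI[OF K], intro allI, rule impI, elim conjE)
    fix \<mu> t :: real and G :: "real^'m^'n" and GN :: "real^'l^'n" and H :: "real^'n^'n"
      and DB :: "real^'m^'m" and DN :: "real^'l^'l" and E11 :: "real^'n^'n" and E12 :: "real^'m^'n" and E13 :: "real^'l^'n"
      and E21 :: "real^'n^'m" and E22 :: "real^'m^'m" and E23 :: "real^'l^'m"
      and E31 :: "real^'n^'l" and E32 :: "real^'m^'l" and E33 :: "real^'l^'l"
      and w yu yv q r5 r6 r7 r8
    assume \<mu>: "0 < \<mu>" "\<mu> \<le> min \<delta> 1" and t: "0 \<le> t" "t \<le> min \<delta> 1"
      and bnd: "opnorm (G - A) \<le> M * \<mu>" "opnorm GN \<le> M" "opnorm H \<le> M" "opnorm DB \<le> M * \<mu>"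
        "opnorm E11 \<le> M * t" "opnorm E33 \<le> M * t / \<mu>"
        "opnorm E12 \<le> M * (t * \<mu>)" "opnorm E21 \<le> M * (t * \<mu>)" "opnorm E22 \<le> M * (t * \<mu>)"
        "opnorm E13 \<le> M * t" "opnorm E31 \<le> M * t" "opnorm E23 \<le> M * t" "opnorm E32 \<le> M * t"
      and Hpos: "\<forall>x. transpose A *v x = 0 \<longrightarrow> (norm x)\<^sup>2 \<le> M * (x \<bullet> (H *v x))"
      and yu: "yu \<in> range ((*v) (transpose A))"
      and yv: "A *v yv = 0" "\<mu> * (norm yv)\<^sup>2 \<le> M * (yv \<bullet> (DB *v yv))"
      and q: "norm q \<le> M * \<mu> * norm (DN *v q)"
      and rows: "(H + E11) *v w + (G + E12) *v (yu + yv) + (GN + E13) *v q = r5"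
        "(transpose G + E21) *v w + (- DB + E22) *v (yu + yv) + E23 *v q = transpose A *v r6 + r7"
        "(transpose GN + E31) *v w + E32 *v (yu + yv) + (- DN + E33) *v q = r8"
    obtain wr wn where w: "w = wr + wn" "wr \<in> range ((*v) A)" "transpose A *v wn = 0"
      using range_kernel_decomposition by blast
    have tm: "0 \<le> t * \<mu>" "0 \<le> t / \<mu>" using \<mu> t by simp_all
    have bnd': "opnorm (G - A) \<le> L * \<mu>" "opnorm GN \<le> L" "opnorm H \<le> L" "opnorm DB \<le> L * \<mu>"
        "opnorm E11 \<le> L * t" "opnorm E33 \<le> L * t / \<mu>"
        "opnorm E12 \<le> L * (t * \<mu>)" "opnorm E21 \<le> L * (t * \<mu>)" "opnorm E22 \<le> L * (t * \<mu>)"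
        "opnorm E13 \<le> L * t" "opnorm E31 \<le> L * t" "opnorm E23 \<le> L * t" "opnorm E32 \<le> L * t"
      using bnd L(1) order_trans[OF _ mult_right_mono[OF L(1), of t]]
        order_trans[OF _ mult_right_mono[OF L(1), of \<mu>]] order_trans[OF _ mult_right_mono[OF L(1), of "t * \<mu>"]]
        order_trans[OF _ mult_right_mono[OF L(1), of "t / \<mu>"]] \<mu>(1) t(1) tm by auto
    have wr: "norm wr \<le> L * norm (transpose A *v wr)"
      using c1[OF w(2)] mult_right_mono[OF L(2), of "norm (transpose A *v wr)"] by (simp del: transpose_matrix_vector)
    have yu': "norm yu \<le> L * norm (A *v yu)"
      using c2[OF yu] mult_right_mono[OF L(3), of "norm (A *v yu)"] by simp
    \<comment> \<open>Enlarging \<open>M\<close> to \<open>L\<close> requires \<open>b\<close> to be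
      nonnegative, and the sign of the left side supplies this for the quadratic forms.\<close>
    have pos_mono: "a \<le> L * b" if "a \<le> M * b" "0 \<le> a" for a b
    proof -
      have "0 \<le> M * b" using that by linarith
      then have "0 \<le> b" using M by (simp add: zero_le_mult_iff)
      then show ?thesis using that(1) mult_right_mono[OF L(1), of b] by linarith
    qed
    have wn: "(norm wn)\<^sup>2 \<le> L * (wn \<bullet> (H *v wn))" using Hpos w(3) by (intro pos_mono) auto
    have yv': "\<mu> * (norm yv)\<^sup>2 \<le> L * (yv \<bullet> (DB *v yv))" using yv(2) \<mu>(1) by (intro pos_mono) auto
    have q': "norm q \<le> L * \<mu> * norm (DN *v q)"
      using pos_mono[of "norm q" "\<mu> * norm (DN *v q)"] q by (simp add: mult.assoc)
    have \<mu>1: "\<mu> \<le> 1" "\<mu> \<le> \<delta>" "t \<le> 1" "t \<le> \<delta>" using \<mu> t by simp_all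
    note est = kkt_estimates[OF L(5) \<mu>(1) \<mu>1(1) t(1) \<mu>1(3) L(4) bnd'(1-9,10-13) wr w(3) wn yu' yv(1) yv' q' w(1) refl rows,
        folded N_def]
    have c: "norm yu \<le> K * (norm r5 + norm r6 + \<mu> * (norm r7 / \<mu>) + \<mu> * norm r8) \<and>
        norm w \<le> K * (norm r5 + norm r6 + \<mu> * (norm r7 / \<mu>) + \<mu> * norm r8) \<and>
        norm yv \<le> K * (norm r5 + norm r6 + norm r7 / \<mu> + (t + \<mu>) * norm r8) \<and>
        norm q / \<mu> \<le> K * (norm r5 + norm r6 + norm r8 + (t + \<mu>) * (norm r7 / \<mu>))"
      apply (rule scal[where WR = "norm wr" and WN = "norm wn"])
      apply (intro conjI est \<mu>(1) \<mu>1 t(1) norm_ge_zero divide_nonneg_pos)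
      using w(1) norm_triangle_ineq by blast
    have "norm q \<le> \<mu> * (K * (norm r5 + norm r6 + norm r8 + (t + \<mu>) * (norm r7 / \<mu>)))"
      using c \<mu>(1) by (simp add: pos_divide_le_eq mult.commute)
    also have "\<dots> = K * \<mu> * (norm r5 + norm r6 + norm r8) + K * (t + \<mu>) * norm r7"
      using \<mu>(1) by (simp add: field_simps)
    finally show "norm yu \<le> K * (norm r5 + norm r6 + norm r7 + \<mu> * norm r8) \<and>
        norm w \<le> K * (norm r5 + norm r6 + norm r7 + \<mu> * norm r8) \<and>
        norm yv \<le> K * (norm r5 + norm r6 + norm r7 / \<mu> + (t + \<mu>) * norm r8) \<and>
        norm q \<le> K * \<mu> * (norm r5 + norm r6 + norm r8) + K * (t + \<mu>) * norm r7"
      using c \<mu>(1) by simp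
  qed
qed

section \<open>Singular vectors\<close>

text \<open>Bessel's inequality: \<open>?p\<close> is the orthogonal projection of \<open>x\<close>
  onto the span of the family, and the squared distance of \<open>x\<close> from it is
  nonnegative.\<close>

lemma L2_set_orthonormal_le:
  fixes q :: "nat \<Rightarrow> 'a::real_inner"
  assumes fin: "finite J" and on: "\<And>k j. k \<in> J \<Longrightarrow> j \<in> J \<Longrightarrow> q k \<bullet> q j = (if k = j then 1 else 0)"
  shows "L2_set (\<lambda>k. q k \<bullet> x) J \<le> norm x"
proof -
  let ?p = "\<Sum>k\<in>J. (q k \<bullet> x) *\<^sub>R q k"
  have qp: "q j \<bullet> ?p = q j \<bullet> x" if "j \<in> J" for j
  proof -
    have "q j \<bullet> ?p = (\<Sum>k\<in>J. if k = j then q j \<bullet> x else 0)"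
      unfolding inner_sum_right by (rule sum.cong) (use on that in auto)
    then show ?thesis using fin that by simp
  qed
  have px: "?p \<bullet> x = (\<Sum>k\<in>J. (q k \<bullet> x)\<^sup>2)" by (simp add: inner_sum_left power2_eq_square)
  have "?p \<bullet> ?p = (\<Sum>k\<in>J. (q k \<bullet> x) * (q k \<bullet> ?p))"
    by (subst (1) inner_sum_left) (simp only: inner_scaleR_left)
  also have "\<dots> = (\<Sum>k\<in>J. (q k \<bullet> x)\<^sup>2)" by (rule sum.cong) (simp_all add: qp power2_eq_square)
  finally have pp: "?p \<bullet> ?p = (\<Sum>k\<in>J. (q k \<bullet> x)\<^sup>2)" .
  have "0 \<le> (x - ?p) \<bullet> (x - ?p)" by (rule inner_ge_zero)
  also have "\<dots> = (norm x)\<^sup>2 - (\<Sum>k\<in>J. (q k \<bullet> x)\<^sup>2)"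
    using px pp by (simp add: inner_diff_left inner_diff_right inner_commute[of x ?p] power2_norm_eq_inner)
  finally have "sqrt (\<Sum>k\<in>J. (q k \<bullet> x)\<^sup>2) \<le> sqrt ((norm x)\<^sup>2)" by (intro real_sqrt_le_mono) simp
  then show ?thesis by (simp add: L2_set_def)
qed

lemma svd_on_mult:
  assumes "svd_on I A r p \<sigma> q"
  shows "A *v x = (\<Sum>k<r. (\<sigma> k * (q k \<bullet> x)) *\<^sub>R p k)"
proof -
  have A: "A = (\<chi> i j. \<Sum>k<r. p k $ i * \<sigma> k * q k $ j)" using assms by (simp add: svd_on_def)
  have "(A *v x) $ i = (\<Sum>k<r. (\<sigma> k * (q k \<bullet> x)) *\<^sub>R p k) $ i" for i
  proof -
    have "(A *v x) $ i = (\<Sum>j\<in>UNIV. \<Sum>k<r. p k $ i * \<sigma> k * q k $ j * x $ j)"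
      by (simp add: A matrix_vector_mult_def sum_distrib_right)
    also have "\<dots> = (\<Sum>k<r. \<Sum>j\<in>UNIV. p k $ i * \<sigma> k * q k $ j * x $ j)" by (rule sum.swap)
    also have "\<dots> = (\<Sum>k<r. (\<sigma> k * (q k \<bullet> x)) *\<^sub>R p k) $ i"
      by (simp add: inner_vec_def sum_distrib_left mult_ac)
    finally show ?thesis .
  qed
  then show ?thesis unfolding Finite_Cartesian_Product.vec_eq_iff by blast
qed

text \<open>The right singular vectors \<open>q k\<close> with \<open>k < r\<close> are orthogonal
  to the kernel of \<open>A\<close>; the later ones lie in that kernel and are therefore orthogonal
  to the range of the transpose. So U^T y sees only \<open>yu\<close> and V^T y only
  \<open>yv\<close>, and Bessel's inequality applies to each.\<close>

lemma svd_norm_le: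
  fixes A :: "real^'m^'n"
  assumes svd: "svd_on I A r p \<sigma> q" and yu: "yu \<in> range ((*v) (transpose A))" and yv: "A *v yv = 0"
  shows "norm_Ut r q (yu + yv) \<le> norm yu" and "norm_Vt I r q (yu + yv) \<le> norm yv"
proof -
  have r: "r \<le> card I" "r \<le> CARD('n)" and \<sigma>: "\<And>k. k < r \<Longrightarrow> 0 < \<sigma> k"
    and pp: "\<And>k j. k < CARD('n) \<Longrightarrow> j < CARD('n) \<Longrightarrow> p k \<bullet> p j = (if k = j then 1 else 0)"
    and qq: "\<And>k j. k < card I \<Longrightarrow> j < card I \<Longrightarrow> q k \<bullet> q j = (if k = j then 1 else 0)"
    using svd by (simp_all add: svd_on_def)
  have qyv: "q j \<bullet> yv = 0" if j: "j < r" for j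
  proof -
    have "0 = p j \<bullet> (\<Sum>k<r. (\<sigma> k * (q k \<bullet> yv)) *\<^sub>R p k)"
      using yv svd_on_mult[OF svd, of yv] by simp
    also have "\<dots> = (\<Sum>k<r. if k = j then \<sigma> j * (q j \<bullet> yv) else 0)"
      unfolding inner_sum_right by (rule sum.cong) (use pp r j in auto)
    also have "\<dots> = \<sigma> j * (q j \<bullet> yv)" using j by simp
    finally show ?thesis using \<sigma>[OF j] by simp
  qed
  have qyu: "q j \<bullet> yu = 0" if j: "j \<in> {r..<card I}" for j
  proof -
    obtain x where x: "yu = transpose A *v x" using yu by blast
    have "A *v q j = 0"
      unfolding svd_on_mult[OF svd] by (rule sum.neutral) (use qq r j in auto)
    then show ?thesis by (simp only: x inner_transpose_mult inner_zero_left)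
  qed
  have "norm_Ut r q (yu + yv) = L2_set (\<lambda>k. q k \<bullet> yu) {..<r}"
    unfolding norm_Ut_def by (rule L2_set_cong) (simp_all add: inner_add_right qyv)
  also have "\<dots> \<le> norm yu" by (rule L2_set_orthonormal_le) (use qq r in auto)
  finally show "norm_Ut r q (yu + yv) \<le> norm yu" .
  have "norm_Vt I r q (yu + yv) = L2_set (\<lambda>k. q k \<bullet> yv) {r..<card I}"
    unfolding norm_Vt_def by (rule L2_set_cong) (simp_all add: inner_add_right qyu)
  also have "\<dots> \<le> norm yv" by (rule L2_set_orthonormal_le) (use qq in auto)
  finally show "norm_Vt I r q (yu + yv) \<le> norm yv" .
qed

section \<open>Derivatives of the Lagrangian\<close>

lemma GDERIV_unique: "GDERIV f z :> a \<Longrightarrow> GDERIV f z :> b \<Longrightarrow> a = b" for a b :: "'a::real_inner"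
  unfolding gderiv_def by (metis (no_types) has_derivative_unique inner_commute vector_eq_ldot)

lemma gradient_eqI: "GDERIV f z :> d \<Longrightarrow> gradient f z = d"
  unfolding gradient_def using GDERIV_unique by (blast intro: the_equality)

text \<open>The adjoint of the derivative at 1 is its Riesz representer, so the definite description
  in \<open>gradient\<close> has a witness.\<close>

lemma GDERIV_gradient:
  assumes "f differentiable (at z)"
  shows "GDERIV f z :> gradient f z"
proof -
  obtain f' where f': "(f has_derivative f') (at z)" using assms unfolding differentiable_def by blast
  then have "linear f'" by (rule has_derivative_linear)
  then have "f' = (\<lambda>h. inner h (adjoint f' 1))" by (simp add: adjoint_works)
  then have "GDERIV f z :> adjoint f' 1" using f' unfolding gderiv_def by simp
  then show ?thesis using gradient_eqI by metis
qed

lemma hessian_has_derivative: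
  assumes "gradient f differentiable (at z)"
  shows "(gradient f has_derivative (\<lambda>h. hessian f z *v h)) (at z)"
  using assms unfolding hessian_def by (simp add: jacobian_works)

lemma hessian_mult_eqI:
  assumes "(gradient f has_derivative f') (at z)"
  shows "hessian f z *v h = f' h"
proof -
  have "gradient f differentiable (at z)" using assms differentiable_def by blast
  then have "(\<lambda>h. hessian f z *v h) = f'"
    using hessian_has_derivative assms has_derivative_unique by blast
  then show ?thesis by metis
qed

text \<open>\<open>norm A\<close> is the Frobenius norm; Cauchy-Schwarz is applied row by
  row.\<close>

lemma norm_matrix_vector_mult_norm_le: "norm (A *v x) \<le> norm A * norm x" for A :: "real^'b^'a"
proof -
  have "norm (A *v x) \<le> L2_set (\<lambda>i. norm (A $ i) * norm x) UNIV"
    unfolding norm_vec_def[of "A *v x"]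
    by (intro L2_set_mono) (auto simp: matrix_vector_mul_component Cauchy_Schwarz_ineq2)
  also have "\<dots> = norm A * norm x" by (simp add: norm_vec_def[of A] L2_set_left_distrib)
  finally show ?thesis .
qed

lemma has_derivative_eventually_le:
  assumes "(f has_derivative f') (at a)" and "e > 0"
  shows "\<forall>\<^sub>F z in nhds a. norm (f z - f a - f' (z - a)) \<le> e * norm (z - a)"
  using assms unfolding has_derivative_at_alt eventually_nhds_metric dist_norm by blast

text \<open>Differentiability gives the two expansions with an arbitrarily small error rate
  \<open>e\<close>; the local Lipschitz condition gives continuity of the Hessian at
  \<open>a\<close>.\<close>

lemma twice_lipschitz_eventually:
  assumes f: "twice_lipschitz_differentiable f" and e: "e > 0"
  shows "\<forall>\<^sub>F z in nhds a. \<bar>f z - f a - gradient f a \<bullet> (z - a)\<bar> \<le> e * norm (z - a) \<and>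
    norm (gradient f z - gradient f a - hessian f a *v (z - a)) \<le> e * norm (z - a) \<and>
    (\<forall>h. norm (hessian f z *v h - hessian f a *v h) \<le> e * norm h)"
proof (intro eventually_conj)
  have d: "f differentiable (at a)" "gradient f differentiable (at a)"
    using f unfolding twice_lipschitz_differentiable_def by auto
  have "(f has_derivative (\<lambda>h. h \<bullet> gradient f a)) (at a)"
    using GDERIV_gradient[OF d(1)] unfolding gderiv_def .
  from has_derivative_eventually_le[OF this e]
  show "\<forall>\<^sub>F z in nhds a. \<bar>f z - f a - gradient f a \<bullet> (z - a)\<bar> \<le> e * norm (z - a)"
    by (simp add: inner_commute)
  show "\<forall>\<^sub>F z in nhds a. norm (gradient f z - gradient f a - hessian f a *v (z - a)) \<le> e * norm (z - a)"
    by (rule has_derivative_eventually_le[OF hessian_has_derivative[OF d(2)] e])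
  obtain r L where r: "r > 0" and L: "L-lipschitz_on (ball a r) (hessian f)"
    using f unfolding twice_lipschitz_differentiable_def by blast
  have "continuous_on (ball a r) (hessian f)" using L by (rule lipschitz_on_continuous_on)
  then have "isCont (hessian f) a" using r by (simp add: continuous_on_eq_continuous_at)
  then have "\<forall>\<^sub>F z in nhds a. dist (hessian f z) (hessian f a) < e"
    using e by (simp add: isCont_def tendsto_at_iff_tendsto_nhds tendstoD)
  then show "\<forall>\<^sub>F z in nhds a. \<forall>h. norm (hessian f z *v h - hessian f a *v h) \<le> e * norm h"
  proof eventually_elim
    case (elim z)
    show ?case
    proof
      fix h
      have "norm (hessian f z *v h - hessian f a *v h) \<le> norm (hessian f z - hessian f a) * norm h"
        using norm_matrix_vector_mult_norm_le[of "hessian f z - hessian f a" h]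
        by (simp add: matrix_vector_mult_diff_rdistrib)
      also have "\<dots> \<le> e * norm h" using elim by (intro mult_right_mono) (auto simp: dist_norm)
      finally show "norm (hessian f z *v h - hessian f a *v h) \<le> e * norm h" .
    qed
  qed
qed

text \<open>Inserting 1 into the minimum covers an empty index set, as happens when no constraint is
  active or none is inactive.\<close>

lemma finite_positive_lower_bound:
  assumes "finite I" and "\<And>i. i \<in> I \<Longrightarrow> (0::real) < f i"
  obtains c where "c > 0" "\<And>i. i \<in> I \<Longrightarrow> c \<le> f i"
proof
  show "Min (insert 1 (f ` I)) > 0" using assms by simp
  show "Min (insert 1 (f ` I)) \<le> f i" if "i \<in> I" for i using assms that by (intro Min_le) auto
qed

lemma grad_matrix_transpose_mult:
  "(transpose (grad_matrix g I z) *v w) $ i = (if i \<in> I then grad_component g i z \<bullet> w else 0)"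
  by (simp add: matrix_vector_mult_def transpose_def grad_matrix_def inner_vec_def del: transpose_matrix_vector)

lemma grad_matrix_mult:
  "grad_matrix g I z *v x = (\<Sum>i\<in>I. x $ i *\<^sub>R grad_component g i z)"
proof -
  have "(grad_matrix g I z *v x) $ k = (\<Sum>i\<in>I. x $ i *\<^sub>R grad_component g i z) $ k" for k
  proof -
    have "(\<Sum>i\<in>UNIV. (if i \<in> I then grad_component g i z $ k else 0) * x $ i)
      = (\<Sum>i\<in>UNIV. if i \<in> I then x $ i * grad_component g i z $ k else 0)"
      by (rule sum.cong) auto
    also have "\<dots> = (\<Sum>i\<in>I. x $ i * grad_component g i z $ k)" by (simp add: sum.If_cases)
    finally show ?thesis by (simp add: matrix_vector_mult_def grad_matrix_def)
  qed
  then show ?thesis unfolding Finite_Cartesian_Product.vec_eq_iff by blast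
qed

lemma ratio_matrix_mult: "(ratio_matrix I l s *v x) $ i = (if i \<in> I then s $ i / l $ i * x $ i else 0)"
proof -
  have "(\<Sum>j\<in>UNIV. (if i = j \<and> i \<in> I then inverse (l $ i) * s $ i else 0) * x $ j)
    = (\<Sum>j\<in>UNIV. if j = i then (if i \<in> I then s $ i / l $ i * x $ i else 0) else 0)"
    by (rule sum.cong) (auto simp: field_simps)
  then show ?thesis by (simp add: matrix_vector_mult_def ratio_matrix_def)
qed

section \<open>Local expansions of the Lagrangian and its ingredients\<close>

locale smooth_nlp =
  fixes \<phi> :: "real^'n \<Rightarrow> real" and g :: "real^'n \<Rightarrow> real^'m"
  assumes smooth_objective: "twice_lipschitz_differentiable \<phi>"
    and smooth_constraint: "\<And>i. twice_lipschitz_differentiable (\<lambda>x. g x $ i)"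
begin

lemma lagrangian_z_eq:
  "lagrangian_z \<phi> g z l = gradient \<phi> z + (\<Sum>i\<in>UNIV. l $ i *\<^sub>R grad_component g i z)"
proof -
  have 1: "(\<phi> has_derivative (\<lambda>h. h \<bullet> gradient \<phi> z)) (at z)"
    using smooth_objective GDERIV_gradient unfolding twice_lipschitz_differentiable_def gderiv_def by blast
  have 2: "((\<lambda>x. g x $ i) has_derivative (\<lambda>h. h \<bullet> grad_component g i z)) (at z)" for i
    using smooth_constraint[of i] GDERIV_gradient unfolding twice_lipschitz_differentiable_def gderiv_def grad_component_def by blast
  have "((\<lambda>x. \<phi> x + (\<Sum>i\<in>UNIV. l $ i * g x $ i)) has_derivative
      (\<lambda>h. h \<bullet> gradient \<phi> z + (\<Sum>i\<in>UNIV. l $ i * (h \<bullet> grad_component g i z)))) (at z)"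
    by (intro has_derivative_add 1 has_derivative_sum has_derivative_mult_right 2)
  then have "GDERIV (\<lambda>x. lagrangian \<phi> g x l) z :> gradient \<phi> z + (\<Sum>i\<in>UNIV. l $ i *\<^sub>R grad_component g i z)"
    unfolding gderiv_def lagrangian_def inner_vec_def[of l] by (simp add: inner_add_right inner_sum_right)
  then show ?thesis unfolding lagrangian_z_def by (rule gradient_eqI)
qed

lemma lagrangian_zz_mult:
  "lagrangian_zz \<phi> g z l *v h = hessian \<phi> z *v h + (\<Sum>i\<in>UNIV. l $ i *\<^sub>R (hessian (\<lambda>x. g x $ i) z *v h))"
proof -
  have eq: "gradient (\<lambda>x. lagrangian \<phi> g x l) = (\<lambda>z. gradient \<phi> z + (\<Sum>i\<in>UNIV. l $ i *\<^sub>R gradient (\<lambda>x. g x $ i) z))"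
    using lagrangian_z_eq[of _ l] by (simp add: fun_eq_iff lagrangian_z_def grad_component_def)
  have 1: "(gradient \<phi> has_derivative (\<lambda>h. hessian \<phi> z *v h)) (at z)"
    using smooth_objective hessian_has_derivative unfolding twice_lipschitz_differentiable_def by blast
  have 2: "(gradient (\<lambda>x. g x $ i) has_derivative (\<lambda>h. hessian (\<lambda>x. g x $ i) z *v h)) (at z)" for i
    using smooth_constraint[of i] hessian_has_derivative unfolding twice_lipschitz_differentiable_def by blast
  show ?thesis unfolding lagrangian_zz_def
    by (rule hessian_mult_eqI, unfold eq) (intro has_derivative_add 1 has_derivative_sum has_derivative_scaleR_right 2)
qed

text \<open>The summand 1 keeps the bound away from 0, so that radii can be obtained by dividing by
  it.\<close>

definition hessian_bound :: "real^'n \<Rightarrow> real" where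
  "hessian_bound z = 1 + norm (hessian \<phi> z) + (\<Sum>i\<in>UNIV. norm (hessian (\<lambda>x. g x $ i) z))"

lemma hessian_bound_ge_1: "1 \<le> hessian_bound z"
  unfolding hessian_bound_def by (simp add: sum_nonneg)

text \<open>The Hessian of the Lagrangian is affine in the multiplier, so the objective cancels from
  the difference.\<close>

lemma norm_lagrangian_zz_diff_le:
  "norm (lagrangian_zz \<phi> g z l *v h - lagrangian_zz \<phi> g z l' *v h) \<le> norm (l - l') * hessian_bound z * norm h"
proof -
  have "lagrangian_zz \<phi> g z l *v h - lagrangian_zz \<phi> g z l' *v h
      = (\<Sum>i\<in>UNIV. (l - l') $ i *\<^sub>R (hessian (\<lambda>x. g x $ i) z *v h))"
    by (simp add: lagrangian_zz_mult scaleR_left_diff_distrib sum_subtractf)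
  also have "norm \<dots> \<le> (\<Sum>i\<in>UNIV. norm (l - l') * (norm (hessian (\<lambda>x. g x $ i) z) * norm h))"
    unfolding norm_scaleR
    by (intro sum_norm_le) (auto intro!: mult_mono norm_matrix_vector_mult_norm_le simp: component_le_norm_cart simp del: vector_minus_component)
  also have "\<dots> = norm (l - l') * ((\<Sum>i\<in>UNIV. norm (hessian (\<lambda>x. g x $ i) z)) * norm h)"
    by (simp add: sum_distrib_left sum_distrib_right)
  also have "\<dots> \<le> norm (l - l') * (hessian_bound z * norm h)"
    by (intro mult_left_mono mult_right_mono) (auto simp: hessian_bound_def)
  finally show ?thesis by (simp add: mult.assoc)
qed

lemma norm_lagrangian_zz_le:
  "norm (lagrangian_zz \<phi> g z l *v h) \<le> (1 + norm l) * hessian_bound z * norm h"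
proof -
  have "lagrangian_zz \<phi> g z 0 *v h = hessian \<phi> z *v h" by (simp add: lagrangian_zz_mult)
  then have "norm (lagrangian_zz \<phi> g z 0 *v h) \<le> norm (hessian \<phi> z) * norm h"
    by (simp add: norm_matrix_vector_mult_norm_le)
  also have "\<dots> \<le> hessian_bound z * norm h"
    by (intro mult_right_mono) (auto simp: hessian_bound_def sum_nonneg)
  finally have "norm (lagrangian_zz \<phi> g z 0 *v h) \<le> hessian_bound z * norm h" .
  then show ?thesis
    using norm_lagrangian_zz_diff_le[of z l h 0] norm_triangle_sub[of "lagrangian_zz \<phi> g z l *v h" "lagrangian_zz \<phi> g z 0 *v h"]
    by (simp add: algebra_simps)
qed

text \<open>A uniform error rate \<open>e\<close> in place of little-o terms: it can be fixed after
  the constants of an argument are known, and one neighbourhood then serves the objective and all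
  constraints.\<close>

definition local_expansion :: "real^'n \<Rightarrow> real \<Rightarrow> real^'n \<Rightarrow> bool" where
  "local_expansion a e z \<longleftrightarrow>
     (\<forall>i. \<bar>g z $ i - g a $ i - grad_component g i a \<bullet> (z - a)\<bar> \<le> e * norm (z - a)) \<and>
     (\<forall>i. norm (grad_component g i z - grad_component g i a - hessian (\<lambda>x. g x $ i) a *v (z - a)) \<le> e * norm (z - a)) \<and>
     norm (gradient \<phi> z - gradient \<phi> a - hessian \<phi> a *v (z - a)) \<le> e * norm (z - a) \<and>
     (\<forall>i h. norm (hessian (\<lambda>x. g x $ i) z *v h - hessian (\<lambda>x. g x $ i) a *v h) \<le> e * norm h) \<and>
     (\<forall>h. norm (hessian \<phi> z *v h - hessian \<phi> a *v h) \<le> e * norm h)"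

lemma eventually_local_expansion:
  assumes "e > 0"
  shows "\<forall>\<^sub>F z in nhds a. local_expansion a e z"
proof -
  have "\<forall>\<^sub>F z in nhds a. \<forall>i. \<bar>g z $ i - g a $ i - grad_component g i a \<bullet> (z - a)\<bar> \<le> e * norm (z - a) \<and>
    norm (grad_component g i z - grad_component g i a - hessian (\<lambda>x. g x $ i) a *v (z - a)) \<le> e * norm (z - a) \<and>
    (\<forall>h. norm (hessian (\<lambda>x. g x $ i) z *v h - hessian (\<lambda>x. g x $ i) a *v h) \<le> e * norm h)"
    unfolding grad_component_def
    by (intro eventually_all_finite twice_lipschitz_eventually[OF smooth_constraint assms])
  with twice_lipschitz_eventually[OF smooth_objective assms, of a]
  show ?thesis by eventually_elim (auto simp: local_expansion_def)
qed

lemma norm_grad_component_diff_le: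
  assumes "local_expansion a e z"
  shows "norm (grad_component g i z - grad_component g i a) \<le> (hessian_bound a + e) * norm (z - a)"
proof -
  let ?H = "hessian (\<lambda>x. g x $ i) a"
  have "norm ?H \<le> hessian_bound a"
    unfolding hessian_bound_def
    using member_le_sum[of i UNIV "\<lambda>i. norm (hessian (\<lambda>x. g x $ i) a)"] by (simp add: add_increasing)
  then have "norm (?H *v (z - a)) \<le> hessian_bound a * norm (z - a)"
    by (meson norm_matrix_vector_mult_norm_le order_trans mult_right_mono norm_ge_zero)
  moreover have "norm (grad_component g i z - grad_component g i a - ?H *v (z - a)) \<le> e * norm (z - a)"
    using assms unfolding local_expansion_def by blast
  ultimately show ?thesis
    using norm_triangle_sub[of "grad_component g i z - grad_component g i a" "?H *v (z - a)"]
    by (simp add: distrib_right)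
qed

lemma norm_lagrangian_zz_local_le:
  assumes "local_expansion a e z" "0 \<le> e"
  shows "norm (lagrangian_zz \<phi> g z l *v h - lagrangian_zz \<phi> g a l *v h)
    \<le> (1 + CARD('m) * norm l) * e * norm h"
proof -
  let ?d = "\<lambda>i. hessian (\<lambda>x. g x $ i) z *v h - hessian (\<lambda>x. g x $ i) a *v h"
  have "lagrangian_zz \<phi> g z l *v h - lagrangian_zz \<phi> g a l *v h
    = (hessian \<phi> z *v h - hessian \<phi> a *v h) + (\<Sum>i\<in>UNIV. l $ i *\<^sub>R ?d i)"
    by (simp add: lagrangian_zz_mult scaleR_right_diff_distrib sum_subtractf)
  also have "norm \<dots> \<le> norm (hessian \<phi> z *v h - hessian \<phi> a *v h) + norm (\<Sum>i\<in>UNIV. l $ i *\<^sub>R ?d i)"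
    by (rule norm_triangle_ineq)
  also have "norm (\<Sum>i\<in>UNIV. l $ i *\<^sub>R ?d i) \<le> (\<Sum>i\<in>(UNIV::'m set). norm l * (e * norm h))"
    unfolding norm_scaleR
    by (intro sum_norm_le) (use assms in \<open>auto intro!: mult_mono simp: component_le_norm_cart local_expansion_def\<close>)
  also have "norm (hessian \<phi> z *v h - hessian \<phi> a *v h) \<le> e * norm h"
    using assms unfolding local_expansion_def by blast
  finally show ?thesis by (simp add: algebra_simps)
qed


subsection \<open>Distance of the iterate from the solution\<close>

text \<open>Complementarity makes a sum of products of one sign vanish, hence every product
  vanishes.\<close>

lemma multiplier_inactive_eq_0:
  assumes "l \<in> multipliers \<phi> g zs" and "i \<notin> active g zs"
  shows "l $ i = 0"
proof -
  have k: "\<And>i. g zs $ i \<le> 0" "\<And>i. 0 \<le> l $ i" "l \<bullet> g zs = 0"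
    using assms(1) by (auto simp: multipliers_def kkt_def)
  have "(\<Sum>i\<in>UNIV. l $ i * (- (g zs $ i))) = 0"
    using k(3) by (simp add: inner_vec_def sum_negf)
  then have "\<forall>i\<in>UNIV. l $ i * (- (g zs $ i)) = 0"
    by (subst (asm) sum_nonneg_eq_0_iff) (use k in \<open>auto intro: mult_nonneg_nonneg mult_nonneg_nonpos\<close>)
  then have "l $ i * (- (g zs $ i)) = 0" by blast
  then show ?thesis using assms(2) by (simp add: active_def)
qed

lemma multiplier_stationarity:
  assumes "l \<in> multipliers \<phi> g zs"
  shows "gradient \<phi> zs + (\<Sum>i\<in>UNIV. l $ i *\<^sub>R grad_component g i zs) = 0"
  using assms lagrangian_z_eq[of zs l] by (simp add: multipliers_def kkt_def)

text \<open>Gauvin's argument: pairing stationarity with the MFCQ direction \<open>y\<close> equates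
  a positively weighted sum of the active multipliers with the fixed number
  \<open>gradient \<phi> zs \<bullet> y\<close>.\<close>

lemma multipliers_bounded:
  assumes "mfcq g zs"
  obtains \<Lambda> where "\<And>l. l \<in> multipliers \<phi> g zs \<Longrightarrow> norm l \<le> \<Lambda>"
proof -
  let ?B = "active g zs"
  obtain y where y: "\<And>i. i \<in> ?B \<Longrightarrow> grad_component g i zs \<bullet> y < 0"
    using assms unfolding mfcq_def by blast
  obtain c where c: "c > 0" "\<And>i. i \<in> ?B \<Longrightarrow> c \<le> - (grad_component g i zs \<bullet> y)"
    using finite_positive_lower_bound[of ?B "\<lambda>i. - (grad_component g i zs \<bullet> y)"] y by auto
  have "norm l \<le> (gradient \<phi> zs \<bullet> y) / c" if l: "l \<in> multipliers \<phi> g zs" for l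
  proof -
    have "c * (l $ i) \<le> l $ i * - (grad_component g i zs \<bullet> y)" for i
    proof (cases "i \<in> ?B")
      case True
      have "0 \<le> l $ i" using l by (auto simp: multipliers_def kkt_def)
      then show ?thesis using mult_left_mono[OF c(2)[OF True], of "l $ i"] by (simp add: mult.commute)
    qed (use multiplier_inactive_eq_0[OF l] in simp)
    then have "c * (\<Sum>i\<in>UNIV. l $ i) \<le> (\<Sum>i\<in>UNIV. l $ i * - (grad_component g i zs \<bullet> y))"
      unfolding sum_distrib_left by (rule sum_mono)
    also have "\<dots> = gradient \<phi> zs \<bullet> y"
      using arg_cong[OF multiplier_stationarity[OF l], of "\<lambda>v. v \<bullet> y"]
      by (simp add: inner_add_left inner_sum_left sum_negf)
    finally have "(\<Sum>i\<in>UNIV. l $ i) \<le> (gradient \<phi> zs \<bullet> y) / c" using c(1) by (simp add: field_simps)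
    moreover have "norm l \<le> (\<Sum>i\<in>UNIV. \<bar>l $ i\<bar>)" by (rule norm_le_l1_cart)
    moreover have "(\<Sum>i\<in>UNIV. \<bar>l $ i\<bar>) = (\<Sum>i\<in>UNIV. l $ i)"
      using l by (intro sum.cong) (auto simp: multipliers_def kkt_def)
    ultimately show ?thesis by simp
  qed
  then show ?thesis using that by blast
qed

lemma lagrangian_zz_coercive:
  assumes "second_order_condition \<phi> g zs" and "strict_complementarity \<phi> g zs"
  obtains \<xi> where "\<xi> > 0"
    "\<And>l w. l \<in> multipliers \<phi> g zs \<Longrightarrow> transpose (grad_matrix g (active g zs) zs) *v w = 0 \<Longrightarrow>
      \<xi> * (norm w)\<^sup>2 \<le> w \<bullet> (lagrangian_zz \<phi> g zs l *v w)"
proof -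
  have ap: "active_plus \<phi> g zs = active g zs"
    using assms(2) unfolding strict_complementarity_def active_plus_def by blast
  have tr: "grad_component g i zs \<bullet> w = 0"
    if "transpose (grad_matrix g (active g zs) zs) *v w = 0" "i \<in> active g zs" for i w
    using grad_matrix_transpose_mult[of g "active g zs" zs w i] that by (simp del: transpose_matrix_vector)
  show ?thesis
    using assms(1) that tr unfolding second_order_condition_def ap
    by (metis DiffD1 DiffD2)
qed

text \<open>A bootstrap: the distance hypothesis yields only closeness of order
  \<open>\<epsilon>\<close>, which legitimizes the expansions and the coercivity; the expansions
  then improve the primal distance to order \<mu>.\<close>

lemma iterate_estimates:
  assumes mf: "mfcq g zs" and soc: "second_order_condition \<phi> g zs"
    and sc: "strict_complementarity \<phi> g zs" and C: "C > 0"
  obtains \<epsilon> M where "\<epsilon> > 0" "1 \<le> M"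
    "\<And>z l s. iterate_conditions \<phi> g C \<gamma> z l s \<Longrightarrow> solution_dist \<phi> g zs z l \<le> \<epsilon> \<Longrightarrow> duality_measure l s \<le> \<epsilon> \<Longrightarrow>
      norm (z - zs) \<le> M * duality_measure l s \<and>
      (\<forall>i\<in>active g zs. s $ i \<le> M * duality_measure l s) \<and>
      (\<forall>i\<in>- active g zs. 1 \<le> M * s $ i) \<and> norm l \<le> M \<and>
      (\<forall>i. norm (grad_component g i z - grad_component g i zs) \<le> M * norm (z - zs)) \<and>
      (\<forall>h. norm (lagrangian_zz \<phi> g z l *v h) \<le> M * norm h) \<and>
      (\<forall>x. transpose (grad_matrix g (active g zs) zs) *v x = 0 \<longrightarrow>
        (norm x)\<^sup>2 \<le> M * (x \<bullet> (lagrangian_zz \<phi> g z l *v x)))"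
proof -
  let ?B = "active g zs"
  let ?A = "grad_matrix g ?B zs"
  let ?H = "\<lambda>l h. lagrangian_zz \<phi> g zs l *v h"
  let ?G = "\<lambda>i. grad_component g i zs"
  define m where "m = real CARD('m)"
  have m: "1 \<le> m" by (simp add: m_def Suc_le_eq)
  obtain \<xi> where \<xi>: "\<xi> > 0"
    "\<And>l w. l \<in> multipliers \<phi> g zs \<Longrightarrow> transpose ?A *v w = 0 \<Longrightarrow> \<xi> * (norm w)\<^sup>2 \<le> w \<bullet> (?H l w)"
    using lagrangian_zz_coercive[OF soc sc] by metis
  obtain \<Lambda>0 where \<Lambda>0: "\<And>l. l \<in> multipliers \<phi> g zs \<Longrightarrow> norm l \<le> \<Lambda>0"
    using multipliers_bounded[OF mf] by blast
  obtain lh where lh: "lh \<in> multipliers \<phi> g zs" "\<And>i. i \<in> ?B \<Longrightarrow> 0 < lh $ i"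
    using sc unfolding strict_complementarity_def by blast
  obtain \<kappa> where \<kappa>: "\<kappa> > 0" "\<And>i. i \<in> ?B \<Longrightarrow> \<kappa> \<le> lh $ i"
    using finite_positive_lower_bound[of ?B "\<lambda>i. lh $ i"] lh(2) by auto
  have gz: "g zs $ i \<le> 0" for i using lh(1) by (auto simp: multipliers_def kkt_def)
  \<comment> \<open>\<open>cN\<close> is at most half of each inactive slack at \<open>zs\<close>,
    so that an amount \<open>cN\<close> can be lost to linearization and residual and
    \<open>cN\<close> still remains.\<close>
  have "0 < - (g zs $ i) / 2" if "i \<in> - ?B" for i
    using gz[of i] that by (auto simp: active_def less_le)
  then obtain cN where cN: "cN > 0" "\<And>i. i \<in> - ?B \<Longrightarrow> cN \<le> - (g zs $ i) / 2"
    using finite_positive_lower_bound[of "- ?B" "\<lambda>i. - (g zs $ i) / 2"] by auto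
  obtain cA0 where cA0: "\<And>x. x \<in> range ((*v) ?A) \<Longrightarrow> norm x \<le> cA0 * norm (transpose ?A *v x)"
    using norm_le_on_range[of ?A] by blast
  define cA where "cA = max 0 cA0"
  have cA: "0 \<le> cA" "\<And>x. x \<in> range ((*v) ?A) \<Longrightarrow> norm x \<le> cA * norm (transpose ?A *v x)"
  proof -
    show "0 \<le> cA" by (simp add: cA_def)
    show "norm x \<le> cA * norm (transpose ?A *v x)" if "x \<in> range ((*v) ?A)" for x
      using cA0[OF that] mult_right_mono[of cA0 cA "norm (transpose ?A *v x)"]
      by (simp add: cA_def del: transpose_matrix_vector)
  qed
  define HB where "HB = hessian_bound zs"
  have HB: "1 \<le> HB" unfolding HB_def by (rule hessian_bound_ge_1)
  define \<Gamma> where "\<Gamma> = (\<Sum>i\<in>UNIV. norm (?G i))"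
  have \<Gamma>: "0 \<le> \<Gamma>" "norm (?G i) \<le> \<Gamma>" for i
    by (auto simp: \<Gamma>_def intro: sum_nonneg member_le_sum)
  define \<Lambda> where "\<Lambda> = \<Lambda>0 + 1"
  have \<Lambda>: "1 \<le> \<Lambda>" using order_trans[OF norm_ge_zero \<Lambda>0[OF lh(1)]] by (simp add: \<Lambda>_def)
  define c1 where "c1 = 1 + m * \<Lambda>"
  define c2 where "c2 = (1 + \<Lambda>) * HB"
  define CN where "CN = m / cN * \<Gamma>"
  define a1 where "a1 = cA * (1 + m * C + m)"
  \<comment> \<open>\<open>Q1\<close> and \<open>Q2\<close> are the factors of the two circular
    estimates \<open>step1\<close> and \<open>step2\<close>, and \<open>Q3\<close> is that of their
    composition; its summand 1 keeps it positive. None of them involves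
    \<open>\<omega>\<close>.\<close>
  define Q1 where "Q1 = a1 + 2 / \<xi> * (C + CN + c1 + c2 * a1)"
  define Q2 where "Q2 = m + C + c2 + c1 + 2 * m * \<Lambda> * C + 2 * m * \<Lambda>"
  define Q3 where "Q3 = Q1 * (Q2 / \<kappa> + 1) + 1"
  have c12: "1 \<le> c1" "1 \<le> c2" "0 \<le> CN" "0 \<le> a1"
  proof -
    show "1 \<le> c1" using m \<Lambda> by (simp add: c1_def)
    have "1 * 1 \<le> (1 + \<Lambda>) * HB" by (intro mult_mono) (use \<Lambda> HB in auto)
    then show "1 \<le> c2" by (simp add: c2_def)
    show "0 \<le> CN" using m cN \<Gamma> by (simp add: CN_def)
    show "0 \<le> a1" using m C cA(1) by (simp add: a1_def)
  qed
  have Q: "0 \<le> Q1" "0 \<le> Q2" "1 \<le> Q3"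
  proof -
    show 1: "0 \<le> Q1" using c12 \<xi>(1) C by (simp add: Q1_def)
    show 2: "0 \<le> Q2" using c12 m \<Lambda> C by (simp add: Q2_def)
    show "1 \<le> Q3" using 1 2 \<kappa>(1) by (simp add: Q3_def)
  qed
  \<comment> \<open>\<open>1 / (2 * Q3)\<close> allows \<open>norm \<Delta>\<close> to be absorbed
    into its own bound, and \<open>\<xi> / (4 * c1)\<close> limits the coercivity lost in moving
    from \<open>zs\<close> to \<open>z\<close>.\<close>
  define \<omega> where "\<omega> = Min {1, 1 / (2 * Q3), \<xi> / (4 * c1)}"
  have \<omega>: "0 < \<omega>" "\<omega> \<le> 1" "\<omega> \<le> 1 / (2 * Q3)" "\<omega> \<le> \<xi> / (4 * c1)"
    using Q c12 \<xi>(1) by (auto simp: \<omega>_def)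
  obtain \<rho> where \<rho>: "\<rho> > 0" "\<And>z. dist z zs < \<rho> \<Longrightarrow> local_expansion zs \<omega> z"
    using eventually_local_expansion[OF \<omega>(1), of zs] unfolding eventually_nhds_metric by blast
  \<comment> \<open>The point of the solution set used below lies within
    \<open>2 * \<epsilon>\<close>. The entries provide, in turn, validity of the expansion,
    \<open>norm \<Delta> \<le> \<omega>\<close>, boundedness of \<open>l\<close>, coercivity for
    \<open>l\<close>, and two halves of \<open>cN\<close> to bound the inactive slacks.\<close>
  define \<epsilon> where "\<epsilon> = Min {\<rho> / 2, \<omega> / 2, 1 / 2, \<xi> / (8 * HB), cN / (2 * C), cN / (4 * (\<Gamma> + 1))}"
  have \<epsilon>: "0 < \<epsilon>" "\<epsilon> \<le> \<rho> / 2" "\<epsilon> \<le> \<omega> / 2" "\<epsilon> \<le> 1 / 2" "\<epsilon> \<le> \<xi> / (8 * HB)"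
      "\<epsilon> \<le> cN / (2 * C)" "\<epsilon> \<le> cN / (4 * (\<Gamma> + 1))"
  proof -
    show "0 < \<epsilon>" using \<rho>(1) \<omega>(1) \<xi>(1) HB cN(1) C \<Gamma>(1) by (simp add: \<epsilon>_def)
  qed (unfold \<epsilon>_def, (rule Min_le; simp only: finite.intros insert_iff simp_thms)+)
  define M where "M = Max {1, 2 * Q3, Q2 / \<kappa> * (1 + 2 * Q3), 1 / cN, \<Lambda>, HB + \<omega>, c2 + c1 * \<omega>, 2 / \<xi>}"
  have M: "1 \<le> M" "2 * Q3 \<le> M" "Q2 / \<kappa> * (1 + 2 * Q3) \<le> M" "1 / cN \<le> M" "\<Lambda> \<le> M" "HB + \<omega> \<le> M"
      "c2 + c1 * \<omega> \<le> M" "2 / \<xi> \<le> M"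
    unfolding M_def by (rule Max_ge; simp only: finite.intros insert_iff simp_thms)+
  show ?thesis
  proof (rule that[OF \<epsilon>(1) M(1)])
    fix z l s
    assume it: "iterate_conditions \<phi> g C \<gamma> z l s" and sd: "solution_dist \<phi> g zs z l \<le> \<epsilon>"
      and \<mu>\<epsilon>: "duality_measure l s \<le> \<epsilon>"
    define \<mu> where "\<mu> = duality_measure l s"
    define \<Delta> where "\<Delta> = z - zs"
    have ls_pos: "0 < l $ i" "0 < s $ i" for i using it by (auto simp: iterate_conditions_def)
    have m\<mu>: "l \<bullet> s = m * \<mu>" by (simp add: \<mu>_def duality_measure_def m_def)
    have li_si: "l $ i * s $ i \<le> m * \<mu>" for i
      using member_le_sum[of i UNIV "\<lambda>i. l $ i * s $ i"] ls_pos m\<mu> by (simp add: inner_vec_def less_imp_le)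
    \<comment> \<open>Any single index will do; the index type is nonempty.\<close>
    have \<mu>0: "0 < \<mu>"
    proof -
      have "0 < m * \<mu>" using li_si[of undefined] ls_pos[of undefined] by (meson less_le_trans mult_pos_pos)
      then show ?thesis using m by (simp add: zero_less_mult_iff)
    qed
    have t: "\<bar>g z $ i + s $ i\<bar> \<le> C * \<mu>" for i
      using component_le_norm_cart[of "g z + s" i] it by (simp add: iterate_conditions_def \<mu>_def)
    have E: "norm (lagrangian_z \<phi> g z l) \<le> C * \<mu>" using it by (simp add: iterate_conditions_def \<mu>_def)
    \<comment> \<open>The infimum is approximated instead of attained, hence the strict inequality
      and the factor 2.\<close>
    have "\<exists>p\<in>{zs} \<times> multipliers \<phi> g zs. dist (z, l) p < 2 * \<epsilon>"
    proof -
      have ne: "{zs} \<times> multipliers \<phi> g zs \<noteq> {}" using lh(1) by auto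
      then have "(INF p\<in>{zs} \<times> multipliers \<phi> g zs. dist (z, l) p) < 2 * \<epsilon>"
        using sd \<epsilon>(1) by (simp add: solution_dist_def infdist_def)
      then show ?thesis using ne by (subst (asm) cINF_less_iff) (auto intro: bdd_belowI2[where m = 0])
    qed
    then obtain ls where ls: "ls \<in> multipliers \<phi> g zs" "dist (z, l) (zs, ls) < 2 * \<epsilon>" by auto
    have \<Delta>: "norm \<Delta> < 2 * \<epsilon>" and ldist: "norm (l - ls) < 2 * \<epsilon>"
      using ls(2) dist_fst_le[of "(z, l)" "(zs, ls)"] dist_snd_le[of "(z, l)" "(zs, ls)"]
      by (auto simp: dist_norm \<Delta>_def)
    have lx: "local_expansion zs \<omega> z" using \<rho>(2)[of z] \<Delta> \<epsilon>(2) by (simp add: dist_norm \<Delta>_def)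
    have \<Delta>\<omega>: "norm \<Delta> \<le> \<omega>" using \<Delta> \<epsilon>(3) by linarith
    have nl: "norm l \<le> \<Lambda>"
      using \<Lambda>0[OF ls(1)] ldist \<epsilon>(4) norm_triangle_sub[of l ls] by (simp add: \<Lambda>_def)
    have nlh: "norm lh \<le> \<Lambda>" using \<Lambda>0[OF lh(1)] by (simp add: \<Lambda>_def)
    have gexp: "\<bar>g z $ i - g zs $ i - ?G i \<bullet> \<Delta>\<bar> \<le> \<omega> * norm \<Delta>" for i
      using lx unfolding local_expansion_def \<Delta>_def by blast
    have sN: "cN \<le> s $ i" if "i \<in> - ?B" for i
    proof -
      have "\<bar>?G i \<bullet> \<Delta>\<bar> \<le> \<Gamma> * norm \<Delta>"
        using Cauchy_Schwarz_ineq2[of "?G i" \<Delta>] mult_right_mono[OF \<Gamma>(2)[of i] norm_ge_zero[of \<Delta>]] by linarith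
      then have "\<bar>g z $ i - g zs $ i\<bar> \<le> (\<Gamma> + 1) * norm \<Delta>"
        using gexp[of i] mult_right_mono[OF \<omega>(2) norm_ge_zero[of \<Delta>]] by (simp add: distrib_right)
      also have "\<dots> \<le> (\<Gamma> + 1) * (2 * \<epsilon>)" using \<Delta> \<Gamma>(1) by (intro mult_left_mono) auto
      also have "\<dots> \<le> cN / 2" using \<epsilon>(7) \<Gamma>(1) by (simp add: field_simps)
      finally have "\<bar>g z $ i - g zs $ i\<bar> \<le> cN / 2" .
      moreover have "C * \<mu> \<le> cN / 2"
      proof -
        have "C * \<mu> \<le> C * (cN / (2 * C))" using \<epsilon>(6) \<mu>\<epsilon> C by (intro mult_left_mono) (auto simp: \<mu>_def)
        then show ?thesis using C by simp
      qed
      ultimately show ?thesis using t[of i] cN(2)[OF that] by linarith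
    qed
    have lN: "l $ i \<le> m / cN * \<mu>" if "i \<in> - ?B" for i
    proof -
      have "l $ i * cN \<le> l $ i * s $ i" using sN[OF that] ls_pos(1)[of i] by (intro mult_left_mono) auto
      then have "l $ i * cN \<le> m * \<mu>" using li_si[of i] by linarith
      then show ?thesis using cN(1) by (simp add: field_simps)
    qed
    \<comment> \<open>Half of \<open>\<xi>\<close> survives: at most a quarter is lost in passing
      from \<open>ls\<close> to \<open>l\<close>, and another in passing from \<open>zs\<close> to
      \<open>z\<close>.\<close>
    have coer: "\<xi> / 2 * (norm x)\<^sup>2 \<le> x \<bullet> (?H l x)" "\<xi> / 2 * (norm x)\<^sup>2 \<le> x \<bullet> (lagrangian_zz \<phi> g z l *v x)"
      if "transpose ?A *v x = 0" for x
    proof -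
      have "norm (?H l x - ?H ls x) \<le> norm (l - ls) * HB * norm x"
        unfolding HB_def by (rule norm_lagrangian_zz_diff_le)
      also have "\<dots> \<le> (2 * \<epsilon>) * HB * norm x" using ldist HB by (intro mult_right_mono) auto
      also have "\<dots> \<le> \<xi> / 4 * norm x" using \<epsilon>(5) HB by (intro mult_right_mono) (auto simp: field_simps)
      finally have d1: "norm (?H l x - ?H ls x) \<le> \<xi> / 4 * norm x" .
      have inn: "\<bar>x \<bullet> v\<bar> \<le> \<xi> / 4 * (norm x)\<^sup>2" if "norm v \<le> \<xi> / 4 * norm x" for v
        using Cauchy_Schwarz_ineq2[of x v] mult_left_mono[OF that norm_ge_zero[of x]]
        by (simp add: power2_eq_square mult_ac)
      have "norm (lagrangian_zz \<phi> g z l *v x - ?H l x) \<le> (1 + CARD('m) * norm l) * \<omega> * norm x"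
        using \<omega>(1) by (intro norm_lagrangian_zz_local_le lx) auto
      also have "\<dots> \<le> c1 * \<omega> * norm x"
        using nl \<omega>(1) by (intro mult_right_mono) (auto simp: c1_def m_def)
      also have "\<dots> \<le> \<xi> / 4 * norm x" using \<omega>(4) c12(1) by (intro mult_right_mono) (auto simp: field_simps)
      finally have d2: "norm (lagrangian_zz \<phi> g z l *v x - ?H l x) \<le> \<xi> / 4 * norm x" .
      have "\<xi> * (norm x)\<^sup>2 \<le> x \<bullet> ?H ls x" by (rule \<xi>(2)[OF ls(1) that])
      moreover have "0 \<le> \<xi> * (norm x)\<^sup>2" using \<xi>(1) by simp
      ultimately show "\<xi> / 2 * (norm x)\<^sup>2 \<le> x \<bullet> (?H l x)" "\<xi> / 2 * (norm x)\<^sup>2 \<le> x \<bullet> (lagrangian_zz \<phi> g z l *v x)"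
        using inn[OF d1] inn[OF d2] unfolding inner_diff_right by linarith+
    qed
    have Hl: "norm (?H l h) \<le> c2 * norm h" for h
    proof -
      have "(1 + norm l) * HB * norm h \<le> c2 * norm h"
        using nl HB unfolding c2_def by (intro mult_right_mono) auto
      then show ?thesis using norm_lagrangian_zz_le[of zs l h] unfolding HB_def by linarith
    qed
    \<comment> \<open>\<open>T\<close> is the gradient of the Lagrangian at \<open>zs\<close> with
      multiplier \<open>l\<close>, since the one with \<open>lh\<close> vanishes; \<open>R\<close>
      is then the Taylor remainder in \<open>z\<close>.\<close>
    define T where "T = (\<Sum>i\<in>UNIV. (l $ i - lh $ i) *\<^sub>R ?G i)"
    define R where "R = lagrangian_z \<phi> g z l - ?H l \<Delta> - T"
    have R: "norm R \<le> c1 * (\<omega> * norm \<Delta>)"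
    proof -
      have "R = (gradient \<phi> z - gradient \<phi> zs - hessian \<phi> zs *v \<Delta>)
          + (\<Sum>i\<in>UNIV. l $ i *\<^sub>R (grad_component g i z - ?G i - hessian (\<lambda>x. g x $ i) zs *v \<Delta>))"
        using multiplier_stationarity[OF lh(1)]
        by (simp add: R_def T_def lagrangian_z_eq lagrangian_zz_mult algebra_simps sum.distrib sum_subtractf eq_neg_iff_add_eq_0)
      then have "norm R \<le> norm (gradient \<phi> z - gradient \<phi> zs - hessian \<phi> zs *v \<Delta>)
          + norm (\<Sum>i\<in>UNIV. l $ i *\<^sub>R (grad_component g i z - ?G i - hessian (\<lambda>x. g x $ i) zs *v \<Delta>))"
        by (simp only: norm_triangle_ineq)
      also have "\<dots> \<le> \<omega> * norm \<Delta> + (\<Sum>i\<in>(UNIV::'m set). \<Lambda> * (\<omega> * norm \<Delta>))"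
      proof (intro add_mono sum_norm_le)
        show "norm (gradient \<phi> z - gradient \<phi> zs - hessian \<phi> zs *v \<Delta>) \<le> \<omega> * norm \<Delta>"
          using lx unfolding local_expansion_def \<Delta>_def by blast
        fix i
        have "\<bar>l $ i\<bar> \<le> \<Lambda>" using component_le_norm_cart[of l i] nl by linarith
        moreover have "norm (grad_component g i z - ?G i - hessian (\<lambda>x. g x $ i) zs *v \<Delta>) \<le> \<omega> * norm \<Delta>"
          using lx unfolding local_expansion_def \<Delta>_def by blast
        ultimately show "norm (l $ i *\<^sub>R (grad_component g i z - ?G i - hessian (\<lambda>x. g x $ i) zs *v \<Delta>))
            \<le> \<Lambda> * (\<omega> * norm \<Delta>)"
          unfolding norm_scaleR using \<Lambda> by (intro mult_mono) auto
      qed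
      also have "\<dots> = c1 * (\<omega> * norm \<Delta>)" by (simp add: c1_def m_def algebra_simps)
      finally show ?thesis .
    qed
    define S where "S = (\<Sum>i\<in>?B. s $ i)"
    have S0: "0 \<le> S" unfolding S_def by (intro sum_nonneg) (use ls_pos in \<open>auto intro: less_imp_le\<close>)
    have siS: "s $ i \<le> S" if "i \<in> ?B" for i
      unfolding S_def using that ls_pos by (intro member_le_sum) (auto intro: less_imp_le)
    have w0: "0 \<le> \<omega> * norm \<Delta>" using \<omega>(1) by simp
    \<comment> \<open>On an active constraint the linearization of \<open>g\<close> equals
      \<open>- s $ i\<close> up to residual and Taylor error. This controls the range component
      \<open>dr\<close>; coercivity controls the kernel component \<open>dn\<close>.\<close>
    have step1: "norm \<Delta> \<le> Q1 * (S + \<mu> + \<omega> * norm \<Delta>)"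
    proof -
      let ?V = "S + \<mu> + \<omega> * norm \<Delta>"
      have V: "0 \<le> S" "0 \<le> \<mu>" "0 \<le> \<omega> * norm \<Delta>" using S0 \<mu>0 w0 by simp_all
      obtain dr dn where d: "\<Delta> = dr + dn" "dr \<in> range ((*v) ?A)" "transpose ?A *v dn = 0"
        using range_kernel_decomposition by blast
      have "transpose ?A *v dr = transpose ?A *v \<Delta>"
        by (simp only: d(1) matrix_vector_right_distrib d(3) add_0_right)
      then have "norm (transpose ?A *v dr) \<le> (\<Sum>i\<in>UNIV. \<bar>(transpose ?A *v \<Delta>) $ i\<bar>)"
        by (simp only: norm_le_l1_cart)
      also have "\<dots> = (\<Sum>i\<in>?B. \<bar>?G i \<bullet> \<Delta>\<bar>)"
        by (simp only: grad_matrix_transpose_mult if_distrib[of abs] abs_zero) (simp add: sum.If_cases)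
      also have "\<dots> \<le> (\<Sum>i\<in>?B. s $ i + (C * \<mu> + \<omega> * norm \<Delta>))"
      proof (rule sum_mono)
        fix i assume "i \<in> ?B"
        then have "g zs $ i = 0" by (simp add: active_def)
        then show "\<bar>?G i \<bullet> \<Delta>\<bar> \<le> s $ i + (C * \<mu> + \<omega> * norm \<Delta>)"
          using t[of i] gexp[of i] ls_pos(2)[of i] by linarith
      qed
      also have "\<dots> = S + real (card ?B) * (C * \<mu> + \<omega> * norm \<Delta>)" by (simp add: sum.distrib S_def)
      also have "\<dots> \<le> S + m * (C * \<mu> + \<omega> * norm \<Delta>)"
        using V C by (intro add_left_mono mult_right_mono) (auto simp: m_def intro: card_mono)
      also have "\<dots> \<le> (1 + m * C + m) * ?V"
      proof -
        have "0 \<le> m * C * (S + \<omega> * norm \<Delta>)" "0 \<le> m * (S + \<mu>)" using m C V by simp_all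
        then show ?thesis using V by (simp add: algebra_simps)
      qed
      finally have "cA * norm (transpose ?A *v dr) \<le> cA * ((1 + m * C + m) * ?V)"
        using cA(1) by (rule mult_left_mono)
      then have dr: "norm dr \<le> a1 * ?V" using cA(2)[OF d(2)] by (simp only: a1_def mult.assoc)
      define TN where "TN = (\<Sum>i\<in>- ?B. l $ i *\<^sub>R ?G i)"
      have dnG: "dn \<bullet> ?G i = 0" if "i \<in> ?B" for i
        using grad_matrix_transpose_mult[of g ?B zs dn i] d(3) that by (simp add: inner_commute del: transpose_matrix_vector)
      \<comment> \<open>\<open>dn\<close> is orthogonal to the active gradients and
        \<open>lh\<close> vanishes off the active set, so of the possibly large
        \<open>l - lh\<close> only the inactive entries of \<open>l\<close> remain, which are of
        order \<mu> by \<open>lN\<close>.\<close>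
      have "dn \<bullet> T = (\<Sum>i\<in>UNIV. if i \<in> - ?B then l $ i * (dn \<bullet> ?G i) else 0)"
        unfolding T_def inner_sum_right
        by (intro sum.cong) (use dnG multiplier_inactive_eq_0[OF lh(1)] in auto)
      also have "\<dots> = dn \<bullet> TN" by (simp add: TN_def inner_sum_right sum.If_cases Compl_eq)
      finally have dnT: "dn \<bullet> T = dn \<bullet> TN" .
      have "norm TN \<le> (\<Sum>i\<in>- ?B. m / cN * \<mu> * norm (?G i))"
        unfolding TN_def
      proof (rule sum_norm_le)
        fix i assume "i \<in> - ?B"
        then show "norm (l $ i *\<^sub>R ?G i) \<le> m / cN * \<mu> * norm (?G i)"
          using mult_right_mono[OF lN[of i] norm_ge_zero[of "?G i"]] ls_pos(1)[of i] by simp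
      qed
      also have "\<dots> = m / cN * \<mu> * (\<Sum>i\<in>- ?B. norm (?G i))" by (simp add: sum_distrib_left)
      also have "\<dots> \<le> m / cN * \<mu> * \<Gamma>"
        unfolding \<Gamma>_def using m cN(1) V by (intro mult_left_mono sum_mono2) auto
      finally have TN: "norm TN \<le> CN * \<mu>" by (simp add: CN_def mult_ac)
      let ?r = "lagrangian_z \<phi> g z l - R - TN - ?H l dr"
      have "?H l dn = lagrangian_z \<phi> g z l - R - T - ?H l dr"
        by (simp add: R_def d(1) matrix_vector_right_distrib)
      then have "dn \<bullet> (?H l dn) = dn \<bullet> ?r" by (simp add: inner_diff_right dnT)
      then have co: "\<xi> / 2 * (norm dn)\<^sup>2 \<le> 1 * (dn \<bullet> ?r)" using coer(1)[OF d(3)] by simp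
      have "norm ?r \<le> norm (lagrangian_z \<phi> g z l) + norm R + norm TN + norm (?H l dr)" by norm
      also have "\<dots> \<le> C * \<mu> + c1 * (\<omega> * norm \<Delta>) + CN * \<mu> + c2 * (a1 * ?V)"
        using E R TN Hl[of dr] mult_left_mono[OF dr, of c2] c12(2) by linarith
      also have "\<dots> \<le> (C + CN + c1 + c2 * a1) * ?V"
      proof -
        have "0 \<le> C * (S + \<omega> * norm \<Delta>)" "0 \<le> CN * (S + \<omega> * norm \<Delta>)" "0 \<le> c1 * (S + \<mu>)"
          using C c12 V by simp_all
        then show ?thesis by (simp add: algebra_simps)
      qed
      finally have r: "norm ?r \<le> (C + CN + c1 + c2 * a1) * ?V" .
      have "\<xi> / 2 * norm dn \<le> 1 * ((C + CN + c1 + c2 * a1) * ?V)"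
        by (rule coercive_imp_norm_le[OF co r]) (use C c12 V in auto)
      then have "norm dn \<le> 2 / \<xi> * (C + CN + c1 + c2 * a1) * ?V"
        using \<xi>(1) by (simp add: field_simps)
      then show ?thesis
        using dr norm_triangle_ineq[of dr dn] unfolding d(1)[symmetric] Q1_def
        by (simp only: distrib_right[of a1])
    qed
    have step2: "\<kappa> * S \<le> Q2 * (\<mu> + \<omega> * norm \<Delta>)"
    proof -
      define D where "D = \<omega> * norm \<Delta>"
      \<comment> \<open>Chosen so that \<open>?G i \<bullet> \<Delta>\<close> equals
        \<open>e i - s $ i - g zs $ i\<close>, with \<open>e i\<close> collecting the feasibility
        residual and the Taylor error.\<close>
      define e where "e i = (g z $ i + s $ i) - (g z $ i - g zs $ i - ?G i \<bullet> \<Delta>)" for i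
      have lh0: "0 \<le> lh $ i" for i using lh(1) by (auto simp: multipliers_def kkt_def)
      have \<Delta>1: "norm \<Delta> \<le> 1" using \<Delta>\<omega> \<omega>(2) by linarith
      have e: "\<bar>e i\<bar> \<le> C * \<mu> + D" for i using t[of i] gexp[of i] by (simp add: e_def D_def)
      have "\<kappa> * S \<le> (\<Sum>i\<in>?B. lh $ i * s $ i)"
        unfolding S_def sum_distrib_left using \<kappa>(2) ls_pos
        by (intro sum_mono mult_right_mono) (auto intro: less_imp_le)
      also have "\<dots> \<le> lh \<bullet> s"
        unfolding inner_vec_def inner_real_def using lh0 ls_pos
        by (intro sum_mono2) (auto intro!: mult_nonneg_nonneg intro: less_imp_le)
      finally have "\<kappa> * S \<le> lh \<bullet> s" .
      moreover have "l \<bullet> g zs \<le> 0"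
        unfolding inner_vec_def inner_real_def using gz ls_pos
        by (intro sum_nonpos mult_nonneg_nonpos) (auto intro: less_imp_le)
      \<comment> \<open>Here \<open>lh \<bullet> s\<close> dominates \<open>\<kappa> * S\<close>,
        while \<open>l \<bullet> s\<close> is exactly \<open>m * \<mu>\<close> and the term in
        \<open>l \<bullet> g zs\<close> has the favourable sign. Closeness of \<open>l\<close> to
        \<open>lh\<close> is never involved.\<close>
      moreover have "\<Delta> \<bullet> T = lh \<bullet> s - m * \<mu> - l \<bullet> g zs + (\<Sum>i\<in>UNIV. (l $ i - lh $ i) * e i)"
      proof -
        have "\<Delta> \<bullet> T = (\<Sum>i\<in>UNIV. (l $ i - lh $ i) * (e i - s $ i - g zs $ i))"
          by (simp add: T_def inner_sum_right e_def inner_commute[of \<Delta>])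
        also have "\<dots> = (\<Sum>i\<in>UNIV. (l $ i - lh $ i) * e i) - l \<bullet> s + lh \<bullet> s - l \<bullet> g zs + lh \<bullet> g zs"
          by (simp add: inner_vec_def algebra_simps sum.distrib sum_subtractf)
        also have "lh \<bullet> g zs = 0" using lh(1) by (simp add: multipliers_def kkt_def)
        finally show ?thesis using m\<mu> by simp
      qed
      moreover have "- (\<Sum>i\<in>UNIV. (l $ i - lh $ i) * e i) \<le> 2 * m * \<Lambda> * (C * \<mu> + D)"
      proof -
        have "norm (\<Sum>i\<in>UNIV. (l $ i - lh $ i) * e i) \<le> (\<Sum>i\<in>(UNIV::'m set). (2 * \<Lambda>) * (C * \<mu> + D))"
        proof (rule sum_norm_le)
          fix i
          have "\<bar>l $ i - lh $ i\<bar> \<le> 2 * \<Lambda>"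
            using component_le_norm_cart[of l i] component_le_norm_cart[of lh i] nl nlh by linarith
          then show "norm ((l $ i - lh $ i) * e i) \<le> (2 * \<Lambda>) * (C * \<mu> + D)"
            unfolding real_norm_def abs_mult using e[of i] \<Lambda> by (intro mult_mono) auto
        qed
        then show ?thesis by (simp add: m_def mult_ac)
      qed
      moreover have "\<Delta> \<bullet> T = \<Delta> \<bullet> lagrangian_z \<phi> g z l - \<Delta> \<bullet> ?H l \<Delta> - \<Delta> \<bullet> R"
        by (simp add: R_def inner_diff_right)
      moreover have "\<Delta> \<bullet> lagrangian_z \<phi> g z l \<le> C * \<mu>"
      proof -
        have "\<Delta> \<bullet> lagrangian_z \<phi> g z l \<le> norm \<Delta> * norm (lagrangian_z \<phi> g z l)" by (rule norm_cauchy_schwarz)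
        also have "\<dots> \<le> 1 * (C * \<mu>)" by (intro mult_mono \<Delta>1 E) auto
        finally show ?thesis by simp
      qed
      \<comment> \<open>\<open>\<Delta>\<close> need not lie in the kernel, so coercivity gives no
        sign. Instead one factor \<open>norm \<Delta>\<close> is traded for \<open>\<omega>\<close>,
        which makes the quadratic term comparable to the linearization error.\<close>
      moreover have "- (\<Delta> \<bullet> ?H l \<Delta>) \<le> c2 * D"
      proof -
        have "\<bar>\<Delta> \<bullet> ?H l \<Delta>\<bar> \<le> norm \<Delta> * norm (?H l \<Delta>)" by (rule Cauchy_Schwarz_ineq2)
        also have "\<dots> \<le> \<omega> * (c2 * norm \<Delta>)" by (intro mult_mono \<Delta>\<omega> Hl) (use \<omega>(1) in auto)
        finally show ?thesis by (simp add: D_def mult_ac)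
      qed
      moreover have "- (\<Delta> \<bullet> R) \<le> c1 * D"
      proof -
        have "\<bar>\<Delta> \<bullet> R\<bar> \<le> norm \<Delta> * norm R" by (rule Cauchy_Schwarz_ineq2)
        also have "\<dots> \<le> 1 * (c1 * D)" unfolding D_def by (intro mult_mono \<Delta>1 R) auto
        finally show ?thesis by simp
      qed
      ultimately have "\<kappa> * S \<le> C * \<mu> + c2 * D + c1 * D + m * \<mu> + 2 * m * \<Lambda> * (C * \<mu> + D)" by linarith
      also have "\<dots> \<le> Q2 * (\<mu> + D)"
      proof -
        have "0 \<le> m * \<Lambda>" "0 \<le> D" using m \<Lambda> w0 by (simp_all add: D_def)
        then have "0 \<le> C * D" "0 \<le> c2 * \<mu>" "0 \<le> c1 * \<mu>" "0 \<le> m * D" "0 \<le> m * \<Lambda> * C * D" "0 \<le> m * \<Lambda> * \<mu>"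
          using C c12 \<mu>0 m by simp_all
        then show ?thesis by (simp add: Q2_def algebra_simps)
      qed
      finally show ?thesis by (simp add: D_def)
    qed
    have S1: "S \<le> Q2 / \<kappa> * (\<mu> + \<omega> * norm \<Delta>)"
      using step2 \<kappa>(1) by (simp add: field_simps)
    \<comment> \<open>Inserting \<open>S1\<close> into \<open>step1\<close> closes the circle; since
      \<open>Q3 * \<omega> \<le> 1 / 2\<close>, half of \<open>norm \<Delta>\<close> stays on the
      left.\<close>
    have \<Delta>\<mu>: "norm \<Delta> \<le> 2 * Q3 * \<mu>"
    proof -
      let ?D = "\<mu> + \<omega> * norm \<Delta>"
      have D0: "0 \<le> ?D" using \<mu>0 w0 by simp
      have "Q1 * (S + ?D) \<le> Q1 * ((Q2 / \<kappa> + 1) * ?D)"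
        using S1 Q(1) by (intro mult_left_mono) (auto simp: distrib_right)
      also have "\<dots> \<le> Q3 * ?D" using D0 by (simp add: Q3_def distrib_right mult.assoc)
      finally have "norm \<Delta> \<le> Q3 * \<mu> + (Q3 * \<omega>) * norm \<Delta>"
        using step1 by (simp add: algebra_simps)
      moreover have "Q3 * \<omega> \<le> 1 / 2" using \<omega>(3) Q(3) by (simp add: field_simps)
      then have "(Q3 * \<omega>) * norm \<Delta> \<le> 1 / 2 * norm \<Delta>" by (rule mult_right_mono) simp
      ultimately show ?thesis by linarith
    qed
    have S\<mu>: "S \<le> M * \<mu>"
    proof -
      have "\<omega> * norm \<Delta> \<le> 1 * norm \<Delta>" by (intro mult_right_mono \<omega>) simp
      then have "\<mu> + \<omega> * norm \<Delta> \<le> (1 + 2 * Q3) * \<mu>" using \<Delta>\<mu> by (simp add: distrib_right)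
      then have "Q2 / \<kappa> * (\<mu> + \<omega> * norm \<Delta>) \<le> Q2 / \<kappa> * ((1 + 2 * Q3) * \<mu>)"
        using Q(2) \<kappa>(1) by (intro mult_left_mono) auto
      also have "\<dots> \<le> M * \<mu>" unfolding mult.assoc[symmetric]
        using mult_right_mono[OF M(3), of \<mu>] \<mu>0 by (simp add: mult.assoc)
      finally show ?thesis using S1 by linarith
    qed
    have f1: "norm (z - zs) \<le> M * \<mu>" using \<Delta>\<mu> mult_right_mono[OF M(2) less_imp_le[OF \<mu>0]] unfolding \<Delta>_def by linarith
    have f2: "\<forall>i\<in>?B. s $ i \<le> M * \<mu>" using siS S\<mu> by force
    have f3: "\<forall>i\<in>- ?B. 1 \<le> M * s $ i"
    proof
      fix i assume "i \<in> - ?B"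
      then have "1 / cN * cN \<le> M * s $ i" using sN cN(1) M by (intro mult_mono) auto
      then show "1 \<le> M * s $ i" using cN(1) by simp
    qed
    have f4: "norm l \<le> M" using nl M by simp
    have f5: "\<forall>i. norm (grad_component g i z - ?G i) \<le> M * norm (z - zs)"
    proof
      fix i
      have "(HB + \<omega>) * norm (z - zs) \<le> M * norm (z - zs)" by (intro mult_right_mono M) simp
      then show "norm (grad_component g i z - ?G i) \<le> M * norm (z - zs)"
        using norm_grad_component_diff_le[OF lx, of i] unfolding HB_def by linarith
    qed
    have f6: "\<forall>h. norm (lagrangian_zz \<phi> g z l *v h) \<le> M * norm h"
    proof
      fix h
      have "norm (lagrangian_zz \<phi> g z l *v h - ?H l h) \<le> (1 + CARD('m) * norm l) * \<omega> * norm h"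
        using \<omega>(1) by (intro norm_lagrangian_zz_local_le lx) auto
      also have "\<dots> \<le> c1 * \<omega> * norm h"
        using nl \<omega>(1) by (intro mult_right_mono) (auto simp: c1_def m_def)
      finally have "norm (lagrangian_zz \<phi> g z l *v h) \<le> (c2 + c1 * \<omega>) * norm h"
        using Hl[of h] norm_triangle_sub[of "lagrangian_zz \<phi> g z l *v h" "?H l h"] by (simp add: distrib_right)
      also have "\<dots> \<le> M * norm h" by (intro mult_right_mono M) simp
      finally show "norm (lagrangian_zz \<phi> g z l *v h) \<le> M * norm h" .
    qed
    have f7: "\<forall>x. transpose ?A *v x = 0 \<longrightarrow> (norm x)\<^sup>2 \<le> M * (x \<bullet> (lagrangian_zz \<phi> g z l *v x))"
    proof (intro allI impI)
      fix x assume x: "transpose ?A *v x = 0"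
      let ?c = "x \<bullet> (lagrangian_zz \<phi> g z l *v x)"
      have c: "\<xi> / 2 * (norm x)\<^sup>2 \<le> ?c" by (rule coer(2)[OF x])
      moreover have "0 \<le> \<xi> / 2 * (norm x)\<^sup>2" using \<xi>(1) by simp
      ultimately have "0 \<le> ?c" by linarith
      have "(norm x)\<^sup>2 \<le> 2 / \<xi> * ?c" using c \<xi>(1) by (simp add: field_simps)
      also have "\<dots> \<le> M * ?c" by (intro mult_right_mono M \<open>0 \<le> ?c\<close>)
      finally show "(norm x)\<^sup>2 \<le> M * ?c" .
    qed
    show "norm (z - zs) \<le> M * duality_measure l s \<and>
      (\<forall>i\<in>?B. s $ i \<le> M * duality_measure l s) \<and>
      (\<forall>i\<in>- ?B. 1 \<le> M * s $ i) \<and> norm l \<le> M \<and>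
      (\<forall>i. norm (grad_component g i z - ?G i) \<le> M * norm (z - zs)) \<and>
      (\<forall>h. norm (lagrangian_zz \<phi> g z l *v h) \<le> M * norm h) \<and>
      (\<forall>x. transpose ?A *v x = 0 \<longrightarrow> (norm x)\<^sup>2 \<le> M * (x \<bullet> (lagrangian_zz \<phi> g z l *v x)))"
      unfolding \<mu>_def[symmetric] by (intro conjI f1 f2 f3 f4 f5 f6 f7)
  qed
qed

section \<open>Operator bounds for the blocks at the iterate\<close>

lemma iterate_matrix_bounds:
  assumes mf: "mfcq g zs" and soc: "second_order_condition \<phi> g zs"
    and sc: "strict_complementarity \<phi> g zs" and C: "C > 0" and \<gamma>: "0 < \<gamma>"
  obtains \<epsilon> M where "\<epsilon> > 0" "1 \<le> M"
    "\<And>z l s \<mu>. iterate_conditions \<phi> g C \<gamma> z l s \<Longrightarrow> solution_dist \<phi> g zs z l \<le> \<epsilon> \<Longrightarrow>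
      \<mu> = duality_measure l s \<Longrightarrow> \<mu> \<le> \<epsilon> \<Longrightarrow>
      0 < \<mu> \<and>
      opnorm (grad_matrix g (active g zs) z - grad_matrix g (active g zs) zs) \<le> M * \<mu> \<and>
      opnorm (grad_matrix g (- active g zs) z) \<le> M \<and>
      opnorm (lagrangian_zz \<phi> g z l) \<le> M \<and>
      opnorm (ratio_matrix (active g zs) l s) \<le> M * \<mu> \<and>
      (\<forall>x. transpose (grad_matrix g (active g zs) zs) *v x = 0 \<longrightarrow>
        (norm x)\<^sup>2 \<le> M * (x \<bullet> (lagrangian_zz \<phi> g z l *v x))) \<and>
      (\<forall>v. vec_on (active g zs) v \<longrightarrow> \<mu> * (norm v)\<^sup>2 \<le> M * (v \<bullet> (ratio_matrix (active g zs) l s *v v))) \<and>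
      (\<forall>q. vec_on (- active g zs) q \<longrightarrow> norm q \<le> M * \<mu> * norm (ratio_matrix (- active g zs) l s *v q))"
proof -
  let ?B = "active g zs"
  let ?G = "\<lambda>z i. grad_component g i z"
  define m where "m = real CARD('m)"
  have m: "1 \<le> m" by (simp add: m_def Suc_le_eq)
  obtain \<epsilon> L where \<epsilon>: "\<epsilon> > 0" and L: "1 \<le> L" and
    est: "\<And>z l s. iterate_conditions \<phi> g C \<gamma> z l s \<Longrightarrow> solution_dist \<phi> g zs z l \<le> \<epsilon> \<Longrightarrow> duality_measure l s \<le> \<epsilon> \<Longrightarrow>
      norm (z - zs) \<le> L * duality_measure l s \<and>
      (\<forall>i\<in>?B. s $ i \<le> L * duality_measure l s) \<and>
      (\<forall>i\<in>- ?B. 1 \<le> L * s $ i) \<and> norm l \<le> L \<and>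
      (\<forall>i. norm (?G z i - ?G zs i) \<le> L * norm (z - zs)) \<and>
      (\<forall>h. norm (lagrangian_zz \<phi> g z l *v h) \<le> L * norm h) \<and>
      (\<forall>x. transpose (grad_matrix g ?B zs) *v x = 0 \<longrightarrow>
        (norm x)\<^sup>2 \<le> L * (x \<bullet> (lagrangian_zz \<phi> g z l *v x)))"
    using iterate_estimates[OF mf soc sc C, of \<gamma>] by metis
  define \<Gamma> where "\<Gamma> = (\<Sum>i\<in>UNIV. norm (?G zs i))"
  have \<Gamma>: "0 \<le> \<Gamma>" "norm (?G zs i) \<le> \<Gamma>" for i
    by (auto simp: \<Gamma>_def intro: sum_nonneg member_le_sum)
  define M where "M = L + m * L\<^sup>2 + m * (\<Gamma> + L\<^sup>2) + L\<^sup>2 / \<gamma>"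
  have M: "1 \<le> M" "L \<le> M" "m * L\<^sup>2 \<le> M" "m * (\<Gamma> + L\<^sup>2) \<le> M" "L\<^sup>2 / \<gamma> \<le> M"
  proof -
    have "0 \<le> m * L\<^sup>2" "0 \<le> m * (\<Gamma> + L\<^sup>2)" "0 \<le> L\<^sup>2 / \<gamma>" using m \<Gamma>(1) \<gamma> by simp_all
    then show "1 \<le> M" "L \<le> M" "m * L\<^sup>2 \<le> M" "m * (\<Gamma> + L\<^sup>2) \<le> M" "L\<^sup>2 / \<gamma> \<le> M"
      using L unfolding M_def by linarith+
  qed
  have sum_bound: "norm (\<Sum>i\<in>I. x $ i *\<^sub>R v i) \<le> m * c * norm x" if "\<And>i. norm (v i) \<le> c"
    for I and x :: "real^'m" and v :: "'m \<Rightarrow> real^'n" and c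
  proof -
    have c: "0 \<le> c" using that order_trans norm_ge_zero by blast
    have "norm (\<Sum>i\<in>I. x $ i *\<^sub>R v i) \<le> (\<Sum>i\<in>I. norm x * c)"
      unfolding norm_scaleR using that
      by (intro sum_norm_le) (auto intro!: mult_mono simp: component_le_norm_cart)
    also have "\<dots> = real (card I) * (norm x * c)" by simp
    also have "\<dots> \<le> m * (norm x * c)"
      using c by (intro mult_right_mono) (auto simp: m_def intro: card_mono)
    finally show ?thesis by (simp add: mult_ac)
  qed
  show ?thesis
  \<comment> \<open>The radius is capped at 1 so that the gradients at \<open>z\<close>, which
    differ from those at \<open>zs\<close> by order \<mu>, are bounded by a constant.\<close>
  proof (rule that[of "min \<epsilon> 1" M])
    show "0 < min \<epsilon> 1" using \<epsilon> by simp
    show "1 \<le> M" by (rule M)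
    fix z l s \<mu>
    assume it: "iterate_conditions \<phi> g C \<gamma> z l s" and sd: "solution_dist \<phi> g zs z l \<le> min \<epsilon> 1"
      and \<mu>: "\<mu> = duality_measure l s" and \<mu>\<epsilon>: "\<mu> \<le> min \<epsilon> 1"
    have pos: "0 < l $ i" "0 < s $ i" for i using it by (auto simp: iterate_conditions_def)
    have low: "\<gamma> * \<mu> \<le> l $ i * s $ i" for i using it \<mu> by (auto simp: iterate_conditions_def)
    have up: "l $ i * s $ i \<le> m * \<mu>" for i
    proof -
      have "l $ i * s $ i \<le> l \<bullet> s"
        unfolding inner_vec_def inner_real_def using pos
        by (intro member_le_sum) (auto intro!: mult_nonneg_nonneg intro: less_imp_le)
      then show ?thesis by (simp add: \<mu> duality_measure_def m_def)
    qed
    have \<mu>0: "0 < \<mu>"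
    proof -
      have "0 < m * \<mu>" using up[of undefined] pos[of undefined] by (meson less_le_trans mult_pos_pos)
      then show ?thesis using m by (simp add: zero_less_mult_iff)
    qed
    have e: "norm (z - zs) \<le> L * \<mu>" "\<And>i. i \<in> ?B \<Longrightarrow> s $ i \<le> L * \<mu>" "\<And>i. i \<in> - ?B \<Longrightarrow> 1 \<le> L * s $ i"
        "norm l \<le> L" "\<And>i. norm (?G z i - ?G zs i) \<le> L * norm (z - zs)"
        "\<And>h. norm (lagrangian_zz \<phi> g z l *v h) \<le> L * norm h"
        "\<And>x. transpose (grad_matrix g ?B zs) *v x = 0 \<Longrightarrow> (norm x)\<^sup>2 \<le> L * (x \<bullet> (lagrangian_zz \<phi> g z l *v x))"
      using est[OF it] sd \<mu> \<mu>\<epsilon> by auto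
    have Gd: "norm (?G z i - ?G zs i) \<le> L\<^sup>2 * \<mu>" for i
    proof -
      have "L * norm (z - zs) \<le> L * (L * \<mu>)" using L by (intro mult_left_mono e(1)) simp
      then show ?thesis using e(5)[of i] by (simp add: power2_eq_square mult.assoc)
    qed
    have c1: "opnorm (grad_matrix g ?B z - grad_matrix g ?B zs) \<le> M * \<mu>"
    proof (rule onorm_bound)
      show "0 \<le> M * \<mu>" using M(1) \<mu>0 by simp
      fix x
      have "(grad_matrix g ?B z - grad_matrix g ?B zs) *v x = (\<Sum>i\<in>?B. x $ i *\<^sub>R (?G z i - ?G zs i))"
        by (simp add: matrix_vector_mult_diff_rdistrib grad_matrix_mult scaleR_right_diff_distrib sum_subtractf)
      then have "norm ((grad_matrix g ?B z - grad_matrix g ?B zs) *v x) \<le> m * (L\<^sup>2 * \<mu>) * norm x"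
        using sum_bound[OF Gd] by simp
      also have "\<dots> = m * L\<^sup>2 * (\<mu> * norm x)" by simp
      also have "\<dots> \<le> M * (\<mu> * norm x)" using \<mu>0 by (intro mult_right_mono M) auto
      finally show "norm ((grad_matrix g ?B z - grad_matrix g ?B zs) *v x) \<le> M * \<mu> * norm x" by simp
    qed
    have c2: "opnorm (grad_matrix g (- ?B) z) \<le> M"
    proof (rule onorm_bound)
      show "0 \<le> M" using M(1) by simp
      fix x
      have "norm (?G z i) \<le> \<Gamma> + L\<^sup>2" for i
      proof -
        have "L\<^sup>2 * \<mu> \<le> L\<^sup>2 * 1" using \<mu>\<epsilon> by (intro mult_left_mono) auto
        then show ?thesis using Gd[of i] \<Gamma>(2)[of i] norm_triangle_sub[of "?G z i" "?G zs i"] by linarith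
      qed
      then have "norm (grad_matrix g (- ?B) z *v x) \<le> m * (\<Gamma> + L\<^sup>2) * norm x"
        unfolding grad_matrix_mult by (rule sum_bound)
      also have "\<dots> \<le> M * norm x" by (intro mult_right_mono M) simp
      finally show "norm (grad_matrix g (- ?B) z *v x) \<le> M * norm x" .
    qed
    have c3: "opnorm (lagrangian_zz \<phi> g z l) \<le> M"
    proof (rule onorm_bound)
      show "norm (lagrangian_zz \<phi> g z l *v h) \<le> M * norm h" for h
        using e(6)[of h] mult_right_mono[OF M(2) norm_ge_zero[of h]] by linarith
    qed (use M in simp)
    \<comment> \<open>The upper bound reads s/l as s^2/(l s), the lower one as (l s)/l^2; both then
      use \<open>l $ i * s $ i \<ge> \<gamma> * \<mu>\<close>.\<close>
    have rB: "s $ i / l $ i \<le> L\<^sup>2 / \<gamma> * \<mu>" "\<mu> \<le> L\<^sup>2 / \<gamma> * (s $ i / l $ i)" if i: "i \<in> ?B" for i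
    proof -
      have "s $ i * (\<gamma> * \<mu>) \<le> s $ i * (l $ i * s $ i)" using low[of i] pos(2)[of i] by (intro mult_left_mono) auto
      also have "\<dots> = l $ i * (s $ i * s $ i)" by simp
      also have "\<dots> \<le> l $ i * ((L * \<mu>) * (L * \<mu>))"
        using e(2)[OF i] pos(1)[of i] pos(2)[of i] by (intro mult_left_mono mult_mono) auto
      finally have "(s $ i * \<gamma>) * \<mu> \<le> (L\<^sup>2 * \<mu> * l $ i) * \<mu>" by (simp add: power2_eq_square mult_ac)
      then have "s $ i * \<gamma> \<le> L\<^sup>2 * \<mu> * l $ i" using \<mu>0 by (rule mult_right_le_imp_le)
      then show "s $ i / l $ i \<le> L\<^sup>2 / \<gamma> * \<mu>" using pos(1)[of i] \<gamma> by (simp add: field_simps)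
      have "l $ i \<le> L" using component_le_norm_cart[of l i] e(4) by linarith
      then have "l $ i * l $ i \<le> L\<^sup>2" unfolding power2_eq_square using pos(1)[of i] by (intro mult_mono) auto
      then have "(l $ i * l $ i) * s $ i \<le> L\<^sup>2 * s $ i" using pos(2)[of i] by (intro mult_right_mono) auto
      moreover have "l $ i * (\<gamma> * \<mu>) \<le> l $ i * (l $ i * s $ i)" using low[of i] pos(1)[of i] by (intro mult_left_mono) auto
      ultimately have "l $ i * (\<gamma> * \<mu>) \<le> L\<^sup>2 * s $ i" by (simp only: mult.assoc)
      then show "\<mu> \<le> L\<^sup>2 / \<gamma> * (s $ i / l $ i)" using pos(1)[of i] \<gamma> by (simp add: field_simps)
    qed
    have c4: "opnorm (ratio_matrix ?B l s) \<le> M * \<mu>"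
    proof (rule onorm_bound)
      show M\<mu>: "0 \<le> M * \<mu>" using M(1) \<mu>0 by simp
      fix v :: "real^'m"
      have "norm (ratio_matrix ?B l s *v v) \<le> norm ((M * \<mu>) *\<^sub>R v)"
      proof (rule norm_le_componentwise_cart)
        fix i
        show "norm ((ratio_matrix ?B l s *v v) $ i) \<le> norm (((M * \<mu>) *\<^sub>R v) $ i)"
        proof (cases "i \<in> ?B")
          case True
          have "s $ i / l $ i \<le> M * \<mu>"
            using rB(1)[OF True] mult_right_mono[OF M(5) less_imp_le[OF \<mu>0]] by linarith
          moreover have "0 \<le> s $ i / l $ i" using pos[of i] by simp
          ultimately have "\<bar>s $ i / l $ i\<bar> \<le> \<bar>M * \<mu>\<bar>" by linarith
          from mult_right_mono[OF this abs_ge_zero[of "v $ i"]] show ?thesis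
            using True by (simp add: ratio_matrix_mult abs_mult)
        qed (simp add: ratio_matrix_mult)
      qed
      then show "norm (ratio_matrix ?B l s *v v) \<le> M * \<mu> * norm v" using M\<mu> by simp
    qed
    \<comment> \<open>The support condition is essential, because the padded ratio matrix vanishes
      off the active set.\<close>
    have c5: "\<mu> * (norm v)\<^sup>2 \<le> M * (v \<bullet> (ratio_matrix ?B l s *v v))" if v: "vec_on ?B v" for v
    proof -
      have "\<mu> * (norm v)\<^sup>2 = (\<Sum>i\<in>UNIV. \<mu> * (v $ i * v $ i))"
        by (simp add: power2_norm_eq_inner inner_vec_def sum_distrib_left)
      also have "\<dots> \<le> (\<Sum>i\<in>UNIV. M * (v $ i * (ratio_matrix ?B l s *v v) $ i))"
      proof (rule sum_mono)
        fix i
        show "\<mu> * (v $ i * v $ i) \<le> M * (v $ i * (ratio_matrix ?B l s *v v) $ i)"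
        proof (cases "i \<in> ?B")
          case True
          have "0 \<le> s $ i / l $ i" using pos[of i] by simp
          then have "\<mu> \<le> M * (s $ i / l $ i)"
            using rB(2)[OF True] mult_right_mono[OF M(5)] order_trans by blast
          then have "\<mu> * (v $ i * v $ i) \<le> M * (s $ i / l $ i) * (v $ i * v $ i)" by (rule mult_right_mono) simp
          then show ?thesis using True by (simp add: ratio_matrix_mult mult_ac)
        qed (use v in \<open>simp add: vec_on_def\<close>)
      qed
      also have "\<dots> = M * (v \<bullet> (ratio_matrix ?B l s *v v))" by (simp add: inner_vec_def sum_distrib_left)
      finally show ?thesis .
    qed
    have c6: "norm q \<le> M * \<mu> * norm (ratio_matrix (- ?B) l s *v q)" if q: "vec_on (- ?B) q" for q
    proof -
      have M\<mu>: "0 \<le> M * \<mu>" using M(1) \<mu>0 by simp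
      have "norm q \<le> norm ((M * \<mu>) *\<^sub>R (ratio_matrix (- ?B) l s *v q))"
      proof (rule norm_le_componentwise_cart)
        fix i
        show "norm (q $ i) \<le> norm (((M * \<mu>) *\<^sub>R (ratio_matrix (- ?B) l s *v q)) $ i)"
        proof (cases "i \<in> - ?B")
          case True
          \<comment> \<open>A slack bounded below forces \<open>l $ i\<close> to be of order \<mu>;
            the second factor \<open>L * s $ i\<close>, again at least 1, produces the ratio
            s/l.\<close>
          have "l $ i * 1 \<le> l $ i * (L * s $ i)" using e(3)[OF True] pos(1)[of i] by (intro mult_left_mono) auto
          also have "\<dots> = L * (l $ i * s $ i)" by simp
          also have "\<dots> \<le> L * (m * \<mu>)" using up[of i] L by (intro mult_left_mono) auto
          also have "\<dots> * 1 \<le> L * (m * \<mu>) * (L * s $ i)"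
            using e(3)[OF True] L m \<mu>0 by (intro mult_left_mono) auto
          finally have "l $ i \<le> (m * L\<^sup>2) * (\<mu> * s $ i)" by (simp add: power2_eq_square mult_ac)
          also have "\<dots> \<le> M * (\<mu> * s $ i)" using \<mu>0 pos(2)[of i] by (intro mult_right_mono M) auto
          finally have "1 \<le> M * \<mu> * (s $ i / l $ i)" using pos(1)[of i] by (simp add: field_simps)
          then have "1 * \<bar>q $ i\<bar> \<le> M * \<mu> * (s $ i / l $ i) * \<bar>q $ i\<bar>" by (rule mult_right_mono) simp
          moreover have "\<bar>M * \<mu> * (s $ i / l $ i)\<bar> = M * \<mu> * (s $ i / l $ i)"
            using M(1) \<mu>0 pos[of i] by (intro abs_of_nonneg mult_nonneg_nonneg) auto
          ultimately have "\<bar>q $ i\<bar> \<le> \<bar>M * \<mu> * (s $ i / l $ i) * q $ i\<bar>" unfolding abs_mult[of _ "q $ i"] by simp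
          then show ?thesis using True by (simp only: ratio_matrix_mult if_True vector_scaleR_component real_norm_def real_scaleR_def mult.assoc)
        qed (use q in \<open>simp add: vec_on_def\<close>)
      qed
      then show ?thesis using M\<mu> by simp
    qed
    have c7: "(norm x)\<^sup>2 \<le> M * (x \<bullet> (lagrangian_zz \<phi> g z l *v x))"
      if "transpose (grad_matrix g ?B zs) *v x = 0" for x
    proof -
      let ?c = "x \<bullet> (lagrangian_zz \<phi> g z l *v x)"
      have *: "(norm x)\<^sup>2 \<le> L * ?c" by (rule e(7)[OF that])
      then have "0 \<le> L * ?c" using zero_le_power2[of "norm x"] by linarith
      then have "0 \<le> ?c" using L by (simp add: zero_le_mult_iff)
      then show ?thesis using * mult_right_mono[OF M(2), of ?c] by linarith
    qed
    show "0 < \<mu> \<and>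
      opnorm (grad_matrix g ?B z - grad_matrix g ?B zs) \<le> M * \<mu> \<and>
      opnorm (grad_matrix g (- ?B) z) \<le> M \<and>
      opnorm (lagrangian_zz \<phi> g z l) \<le> M \<and>
      opnorm (ratio_matrix ?B l s) \<le> M * \<mu> \<and>
      (\<forall>x. transpose (grad_matrix g ?B zs) *v x = 0 \<longrightarrow>
        (norm x)\<^sup>2 \<le> M * (x \<bullet> (lagrangian_zz \<phi> g z l *v x))) \<and>
      (\<forall>v. vec_on ?B v \<longrightarrow> \<mu> * (norm v)\<^sup>2 \<le> M * (v \<bullet> (ratio_matrix ?B l s *v v))) \<and>
      (\<forall>q. vec_on (- ?B) q \<longrightarrow> norm q \<le> M * \<mu> * norm (ratio_matrix (- ?B) l s *v q))"
      using \<mu>0 c1 c2 c3 c4 c5 c6 c7 by blast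
  qed
qed

end

section \<open>Bounds for the perturbed step in singular vector coordinates\<close>

theorem theorem4p2:
  fixes \<phi> :: "real^'n \<Rightarrow> real" and g :: "real^'n \<Rightarrow> real^'m" and zs :: "real^'n"
    and C \<gamma> K :: real and B N :: "'m set"
  defines "B \<equiv> active g zs" and "N \<equiv> - active g zs"
  assumes "twice_lipschitz_differentiable \<phi>"
    and "\<And>i. twice_lipschitz_differentiable (\<lambda>x. g x $ i)"
    and "nlp_local_solution \<phi> g zs"
    and "multipliers \<phi> g zs \<noteq> {}"
    and "mfcq g zs"
    and "second_order_condition \<phi> g zs"
    and "strict_complementarity \<phi> g zs"
    and "C > 0" and "0 < \<gamma>" and "\<gamma> < 1" and "K > 0"
  shows "\<exists>\<epsilon>>0. \<exists>\<eta>>0. \<exists>\<beta>\<^sub>0>0. \<exists>K'>0.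
    \<forall>(z :: real^'n) (l :: real^'m) (s :: real^'m) (\<mu> :: real) (u :: real) (\<beta> :: real)
     (r :: nat) (uh :: nat \<Rightarrow> real^'n) (\<sigma> :: nat \<Rightarrow> real) (v :: nat \<Rightarrow> real^'m)
     (E11 :: real^'n^'n) (E12 :: real^'m^'n) (E13 :: real^'m^'n)
     (E21 :: real^'n^'m) (E22 :: real^'m^'m) (E23 :: real^'m^'m)
     (E31 :: real^'n^'m) (E32 :: real^'m^'m) (E33 :: real^'m^'m)
     (r5 :: real^'n) (r6 :: real^'n) (r7 :: real^'m) (r8 :: real^'m)
     (w :: real^'n) (y :: real^'m) (q :: real^'m).
      iterate_conditions \<phi> g C \<gamma> z l s \<and> \<mu> = duality_measure l s \<and>
      solution_dist \<phi> g zs z l \<le> \<epsilon> \<and> \<mu> \<le> \<epsilon> \<and>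
      0 \<le> u \<and> u / \<mu> \<le> \<eta> \<and> u \<le> \<eta> \<and> \<beta>\<^sub>0 \<le> \<beta> \<and>
      svd_on B (grad_matrix g B zs) r uh \<sigma> v \<and>
      sigma_min (sv_matrix r \<sigma>) \<ge> ereal (\<beta> * max (\<mu> powr (1/3)) (u / \<mu>)) \<and>
      (\<forall>ls\<in>multipliers \<phi> g zs.
         sigma_min (reduced_matrix r uh (lagrangian_zz \<phi> g zs ls))
           \<ge> ereal (\<beta> * max (\<mu> powr (1/3)) (u / \<mu>))) \<and>
      mat_on UNIV B E12 \<and> mat_on UNIV N E13 \<and>
      mat_on B UNIV E21 \<and> mat_on B B E22 \<and> mat_on B N E23 \<and>
      mat_on N UNIV E31 \<and> mat_on N B E32 \<and> mat_on N N E33 \<and>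
      opnorm E11 \<le> K * u / \<mu> \<and> opnorm E33 \<le> K * u / \<mu>\<^sup>2 \<and>
      opnorm E12 \<le> K * u \<and> opnorm E21 \<le> K * u \<and> opnorm E22 \<le> K * u \<and>
      opnorm E13 \<le> K * u / \<mu> \<and> opnorm E31 \<le> K * u / \<mu> \<and>
      opnorm E23 \<le> K * u / \<mu> \<and> opnorm E32 \<le> K * u / \<mu> \<and>
      vec_on B r7 \<and> vec_on N r8 \<and> vec_on B y \<and> vec_on N q \<and>
      (lagrangian_zz \<phi> g z l + E11) *v w + (grad_matrix g B z + E12) *v y
        + (grad_matrix g N z + E13) *v q = r5 \<and>
      (transpose (grad_matrix g B z) + E21) *v w + (- ratio_matrix B l s + E22) *v y
        + E23 *v q = transpose (grad_matrix g B zs) *v r6 + r7 \<and>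
      (transpose (grad_matrix g N z) + E31) *v w + E32 *v y
        + (- ratio_matrix N l s + E33) *v q = r8
      \<longrightarrow>
      norm (norm_Ut r v y, w) \<le> K' * (norm r5 + norm r6 + norm r7 + \<mu> * norm r8) \<and>
      norm_Vt B r v y \<le> K' * (norm r5 + norm r6 + norm r7 / \<mu>
                              + (K' * u / \<mu> + K' * \<mu>) * norm r8) \<and>
      norm q \<le> K' * \<mu> * (norm r5 + norm r6 + norm r8) + (K' * u / \<mu> + K' * \<mu>) * norm r7"
proof -
  interpret smooth_nlp \<phi> g using assms(3,4) by unfold_locales
  let ?A = "grad_matrix g B zs"
  obtain \<epsilon> M0 where \<epsilon>: "\<epsilon> > 0" and M0: "1 \<le> M0" and
    it: "\<And>z l s \<mu>. iterate_conditions \<phi> g C \<gamma> z l s \<Longrightarrow> solution_dist \<phi> g zs z l \<le> \<epsilon> \<Longrightarrow>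
      \<mu> = duality_measure l s \<Longrightarrow> \<mu> \<le> \<epsilon> \<Longrightarrow>
      0 < \<mu> \<and>
      opnorm (grad_matrix g B z - ?A) \<le> M0 * \<mu> \<and>
      opnorm (grad_matrix g N z) \<le> M0 \<and>
      opnorm (lagrangian_zz \<phi> g z l) \<le> M0 \<and>
      opnorm (ratio_matrix B l s) \<le> M0 * \<mu> \<and>
      (\<forall>x. transpose ?A *v x = 0 \<longrightarrow> (norm x)\<^sup>2 \<le> M0 * (x \<bullet> (lagrangian_zz \<phi> g z l *v x))) \<and>
      (\<forall>v. vec_on B v \<longrightarrow> \<mu> * (norm v)\<^sup>2 \<le> M0 * (v \<bullet> (ratio_matrix B l s *v v))) \<and>
      (\<forall>q. vec_on N q \<longrightarrow> norm q \<le> M0 * \<mu> * norm (ratio_matrix N l s *v q))"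
    using iterate_matrix_bounds[OF assms(7-11)] unfolding B_def N_def by metis
  \<comment> \<open>\<open>M0\<close> bounds the exact blocks and \<open>K\<close> their
    perturbations; the linear estimate takes one constant for both.\<close>
  define M where "M = max M0 K"
  have M: "1 \<le> M" "M0 \<le> M" "K \<le> M" using M0 by (auto simp: M_def)
  obtain \<delta> K1 where \<delta>: "\<delta> > 0" and K1: "1 \<le> K1" and
    lin: "\<And>\<mu> t (G :: real^'m^'n) (GN :: real^'m^'n) (H :: real^'n^'n)
      (DB :: real^'m^'m) (DN :: real^'m^'m) (E11 :: real^'n^'n) (E12 :: real^'m^'n) (E13 :: real^'m^'n)
      (E21 :: real^'n^'m) (E22 :: real^'m^'m) (E23 :: real^'m^'m)
      (E31 :: real^'n^'m) (E32 :: real^'m^'m) (E33 :: real^'m^'m) w yu yv q r5 r6 r7 r8.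
    0 < \<mu> \<and> \<mu> \<le> \<delta> \<and> 0 \<le> t \<and> t \<le> \<delta> \<and>
    opnorm (G - ?A) \<le> M * \<mu> \<and> opnorm GN \<le> M \<and> opnorm H \<le> M \<and> opnorm DB \<le> M * \<mu> \<and>
    opnorm E11 \<le> M * t \<and> opnorm E33 \<le> M * t / \<mu> \<and>
    opnorm E12 \<le> M * (t * \<mu>) \<and> opnorm E21 \<le> M * (t * \<mu>) \<and> opnorm E22 \<le> M * (t * \<mu>) \<and>
    opnorm E13 \<le> M * t \<and> opnorm E31 \<le> M * t \<and> opnorm E23 \<le> M * t \<and> opnorm E32 \<le> M * t \<and>
    (\<forall>x. transpose ?A *v x = 0 \<longrightarrow> (norm x)\<^sup>2 \<le> M * (x \<bullet> (H *v x))) \<and>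
    yu \<in> range ((*v) (transpose ?A)) \<and> ?A *v yv = 0 \<and> \<mu> * (norm yv)\<^sup>2 \<le> M * (yv \<bullet> (DB *v yv)) \<and>
    norm q \<le> M * \<mu> * norm (DN *v q) \<and>
    (H + E11) *v w + (G + E12) *v (yu + yv) + (GN + E13) *v q = r5 \<and>
    (transpose G + E21) *v w + (- DB + E22) *v (yu + yv) + E23 *v q = transpose ?A *v r6 + r7 \<and>
    (transpose GN + E31) *v w + E32 *v (yu + yv) + (- DN + E33) *v q = r8
    \<Longrightarrow> norm yu \<le> K1 * (norm r5 + norm r6 + norm r7 + \<mu> * norm r8) \<and>
        norm w \<le> K1 * (norm r5 + norm r6 + norm r7 + \<mu> * norm r8) \<and>
        norm yv \<le> K1 * (norm r5 + norm r6 + norm r7 / \<mu> + (t + \<mu>) * norm r8) \<and>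
        norm q \<le> K1 * \<mu> * (norm r5 + norm r6 + norm r8) + K1 * (t + \<mu>) * norm r7"
    using perturbed_kkt_bounds[OF M(1), of ?A, where 'l = 'm] by (elim exE conjE) blast
  show ?thesis
  \<comment> \<open>The same \<open>\<delta>\<close> limits \<mu> and u/\<mu>. The factor 2 in
    \<open>2 * K1\<close> comes from bounding the norm of the pair by the sum of the norms of its
    two parts.\<close>
  proof (rule exI[of _ "min \<epsilon> \<delta>"], rule conjI, use \<epsilon> \<delta> in simp, rule exI[of _ \<delta>], rule conjI, rule \<delta>,
      rule exI[of _ 1], rule conjI, simp, rule exI[of _ "2 * K1"], rule conjI, use K1 in simp, intro allI, rule impI, elim conjE)
    fix z l s \<mu> u \<beta> r uh \<sigma> v
      and E11 :: "real^'n^'n" and E12 E13 :: "real^'m^'n" and E21 :: "real^'n^'m" and E22 E23 :: "real^'m^'m"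
      and E31 :: "real^'n^'m" and E32 E33 :: "real^'m^'m" and r5 r6 r7 r8 w y q
    assume A1: "iterate_conditions \<phi> g C \<gamma> z l s" "\<mu> = duality_measure l s"
        "solution_dist \<phi> g zs z l \<le> min \<epsilon> \<delta>" "\<mu> \<le> min \<epsilon> \<delta>"
      and u: "0 \<le> u" "u / \<mu> \<le> \<delta>"
      and svd: "svd_on B ?A r uh \<sigma> v"
      and E: "opnorm E11 \<le> K * u / \<mu>" "opnorm E33 \<le> K * u / \<mu>\<^sup>2"
        "opnorm E12 \<le> K * u" "opnorm E21 \<le> K * u" "opnorm E22 \<le> K * u"
        "opnorm E13 \<le> K * u / \<mu>" "opnorm E31 \<le> K * u / \<mu>"
        "opnorm E23 \<le> K * u / \<mu>" "opnorm E32 \<le> K * u / \<mu>"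
      and on: "vec_on B y" "vec_on N q"
      and rows: "(lagrangian_zz \<phi> g z l + E11) *v w + (grad_matrix g B z + E12) *v y
        + (grad_matrix g N z + E13) *v q = r5"
        "(transpose (grad_matrix g B z) + E21) *v w + (- ratio_matrix B l s + E22) *v y
        + E23 *v q = transpose ?A *v r6 + r7"
        "(transpose (grad_matrix g N z) + E31) *v w + E32 *v y
        + (- ratio_matrix N l s + E33) *v q = r8"
    have b: "0 < \<mu>" "opnorm (grad_matrix g B z - ?A) \<le> M0 * \<mu>" "opnorm (grad_matrix g N z) \<le> M0"
      "opnorm (lagrangian_zz \<phi> g z l) \<le> M0" "opnorm (ratio_matrix B l s) \<le> M0 * \<mu>"
      "\<And>x. transpose ?A *v x = 0 \<Longrightarrow> (norm x)\<^sup>2 \<le> M0 * (x \<bullet> (lagrangian_zz \<phi> g z l *v x))"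
      "\<And>v. vec_on B v \<Longrightarrow> \<mu> * (norm v)\<^sup>2 \<le> M0 * (v \<bullet> (ratio_matrix B l s *v v))"
      "\<And>q. vec_on N q \<Longrightarrow> norm q \<le> M0 * \<mu> * norm (ratio_matrix N l s *v q)"
      using it[OF A1(1) _ A1(2)] A1(3,4) by auto
    \<comment> \<open>The perturbation sizes u, u/\<mu> and u/\<mu>^2 become
      \<open>t * \<mu>\<close>, \<open>t\<close> and \<open>t / \<mu>\<close>.\<close>
    define t where "t = u / \<mu>"
    have ut: "u = t * \<mu>" and t: "0 \<le> t" using b(1) u(1) by (simp_all add: t_def)
    have pos_mono: "a \<le> M * c" if "a \<le> M0 * c" "0 \<le> a" for a c
    proof -
      have "0 \<le> M0 * c" using that by linarith
      then have "0 \<le> c" using M0 by (simp add: zero_le_mult_iff)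
      then show ?thesis using that(1) mult_right_mono[OF M(2), of c] by linarith
    qed
    have Kt: "K * t \<le> M * t" "K * (t * \<mu>) \<le> M * (t * \<mu>)" "K * t / \<mu> \<le> M * t / \<mu>"
      using M(3) t b(1) by (auto intro: mult_right_mono divide_right_mono)
    \<comment> \<open>The splitting is applied to the transpose of the gradient matrix, so
      \<open>yu\<close> is in the range of the transpose and \<open>yv\<close> in the kernel of the
      matrix itself.\<close>
    obtain yu yv where y: "y = yu + yv" "yu \<in> range ((*v) (transpose ?A))" "transpose (transpose ?A) *v yv = 0"
      using range_kernel_decomposition by blast
    have yv: "?A *v yv = 0" using y(3) by (simp only: Finite_Cartesian_Product.transpose_transpose)
    \<comment> \<open>The kernel of the padded gradient matrix contains every vector supported off
      \<open>B\<close>, where the active diagonal block is zero. Vectors in the range of the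
      transpose vanish there, so \<open>yv\<close> inherits the support of \<open>y\<close> and
      coercivity applies to it.\<close>
    have "vec_on B yv"
    proof -
      obtain x where x: "yu = transpose ?A *v x" using y(2) by blast
      have "yv $ i = 0" if "i \<notin> B" for i
      proof -
        have "yu $ i = 0" using that by (simp only: x grad_matrix_transpose_mult if_False)
        moreover have "y $ i = 0" using on(1) that by (simp add: vec_on_def)
        ultimately show ?thesis by (simp add: y(1))
      qed
      then show ?thesis by (simp add: vec_on_def)
    qed
    have "norm yu \<le> K1 * (norm r5 + norm r6 + norm r7 + \<mu> * norm r8) \<and>
        norm w \<le> K1 * (norm r5 + norm r6 + norm r7 + \<mu> * norm r8) \<and>
        norm yv \<le> K1 * (norm r5 + norm r6 + norm r7 / \<mu> + (t + \<mu>) * norm r8) \<and>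
        norm q \<le> K1 * \<mu> * (norm r5 + norm r6 + norm r8) + K1 * (t + \<mu>) * norm r7"
    proof (rule lin, intro conjI allI impI)
      show "0 < \<mu>" "\<mu> \<le> \<delta>" "0 \<le> t" "t \<le> \<delta>" using b(1) A1(4) t u(2) by (auto simp: t_def)
      show "opnorm (grad_matrix g B z - ?A) \<le> M * \<mu>" "opnorm (ratio_matrix B l s) \<le> M * \<mu>"
        using b(2,5) mult_right_mono[OF M(2) less_imp_le[OF b(1)]] by linarith+
      show "opnorm (grad_matrix g N z) \<le> M" "opnorm (lagrangian_zz \<phi> g z l) \<le> M" using b(3,4) M(2) by linarith+
      show "opnorm E11 \<le> M * t" "opnorm E13 \<le> M * t" "opnorm E31 \<le> M * t" "opnorm E23 \<le> M * t" "opnorm E32 \<le> M * t"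
        using E Kt(1) by (simp_all add: t_def)
      show "opnorm E12 \<le> M * (t * \<mu>)" "opnorm E21 \<le> M * (t * \<mu>)" "opnorm E22 \<le> M * (t * \<mu>)"
        using E(3-5) Kt(2) unfolding ut[symmetric] by linarith+
      have "K * u / \<mu>\<^sup>2 = K * t / \<mu>" by (simp add: t_def power2_eq_square)
      then show "opnorm E33 \<le> M * t / \<mu>" using E(2) Kt(3) by linarith
      show "(norm x)\<^sup>2 \<le> M * (x \<bullet> (lagrangian_zz \<phi> g z l *v x))" if "transpose ?A *v x = 0" for x
        by (rule pos_mono[OF b(6)[OF that]]) simp
      show "yu \<in> range ((*v) (transpose ?A))" "?A *v yv = 0" by (rule y(2), rule yv)
      show "\<mu> * (norm yv)\<^sup>2 \<le> M * (yv \<bullet> (ratio_matrix B l s *v yv))"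
        by (rule pos_mono[OF b(7)[OF \<open>vec_on B yv\<close>]]) (use b(1) in simp)
      show "norm q \<le> M * \<mu> * norm (ratio_matrix N l s *v q)"
        using pos_mono[of "norm q" "\<mu> * norm (ratio_matrix N l s *v q)"] b(8)[OF on(2)] by (simp add: mult.assoc)
    qed (use rows in \<open>simp_all only: y(1)[symmetric]\<close>)
    then have c: "norm yu \<le> K1 * (norm r5 + norm r6 + norm r7 + \<mu> * norm r8)"
        "norm w \<le> K1 * (norm r5 + norm r6 + norm r7 + \<mu> * norm r8)"
        "norm yv \<le> K1 * (norm r5 + norm r6 + norm r7 / \<mu> + (t + \<mu>) * norm r8)"
        "norm q \<le> K1 * \<mu> * (norm r5 + norm r6 + norm r8) + K1 * (t + \<mu>) * norm r7" by blast+
    have nn: "0 \<le> norm_Ut r v y" by (simp add: norm_Ut_def)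
    have UV: "norm_Ut r v y \<le> norm yu" "norm_Vt B r v y \<le> norm yv"
      unfolding y(1) by (rule svd_norm_le[OF svd y(2) yv])+
    have tm: "2 * K1 * u / \<mu> + 2 * K1 * \<mu> = 2 * K1 * (t + \<mu>)" by (simp add: t_def distrib_left)
    have "norm (norm_Ut r v y, w) \<le> norm_Ut r v y + norm w"
      using norm_Pair_le[of "norm_Ut r v y" w] nn by simp
    then have r1: "norm (norm_Ut r v y, w) \<le> 2 * K1 * (norm r5 + norm r6 + norm r7 + \<mu> * norm r8)"
      using c(1,2) UV(1) by linarith
    have r2: "norm_Vt B r v y \<le> 2 * K1 * (norm r5 + norm r6 + norm r7 / \<mu> + (2 * K1 * u / \<mu> + 2 * K1 * \<mu>) * norm r8)"
    proof -
      \<comment> \<open>The inner constant of the claimed bound is again \<open>2 * K1\<close>;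
        inserting it only weakens the estimate since it is at least 1.\<close>
      have "(t + \<mu>) * norm r8 \<le> 2 * K1 * (t + \<mu>) * norm r8"
        using K1 t b(1) by (intro mult_right_mono) (auto simp: mult_le_cancel_right1)
      then have "K1 * (norm r5 + norm r6 + norm r7 / \<mu> + (t + \<mu>) * norm r8)
          \<le> 2 * K1 * (norm r5 + norm r6 + norm r7 / \<mu> + 2 * K1 * (t + \<mu>) * norm r8)"
        using K1 t b(1) by (intro mult_mono) auto
      then show ?thesis unfolding tm using c(3) UV(2) by linarith
    qed
    have r3: "norm q \<le> 2 * K1 * \<mu> * (norm r5 + norm r6 + norm r8) + (2 * K1 * u / \<mu> + 2 * K1 * \<mu>) * norm r7"
    proof -
      have "0 \<le> K1 * \<mu> * (norm r5 + norm r6 + norm r8)" "0 \<le> K1 * (t + \<mu>) * norm r7" using K1 t b(1) by simp_all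
      then show ?thesis unfolding tm using c(4) by linarith
    qed
    show "norm (norm_Ut r v y, w) \<le> 2 * K1 * (norm r5 + norm r6 + norm r7 + \<mu> * norm r8) \<and>
      norm_Vt B r v y \<le> 2 * K1 * (norm r5 + norm r6 + norm r7 / \<mu> + (2 * K1 * u / \<mu> + 2 * K1 * \<mu>) * norm r8) \<and>
      norm q \<le> 2 * K1 * \<mu> * (norm r5 + norm r6 + norm r8) + (2 * K1 * u / \<mu> + 2 * K1 * \<mu>) * norm r7"
      by (intro conjI r1 r2 r3)
  qed
qed

end
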